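(* Let $\mathcal U$ be a nondiscrete unital subring of $\mathbb R$. Suppose $A,B$ are positive matrices over $\mathcal U$ which are strong shift equivalent over $\mathcal U$. Then $A$ and $B$ are strong shift equivalent over $\mathcal U_+$, respectively, to positive matrices $A'$ and $B'$ which are conjugate over $\mathcal U$; that is, $A'$ and $B'$ have the same size $n$ and there is $W\in\mathrm{GL}(n,\mathcal U)$ with $W^{-1}A'W=B'$. Moreover, the conjugating matrix $W$ can be chosen to have positive determinant and to send positive eigenvectors to positive eigenvectors.
   Context: A matrix or vector is positive if all its entries are positive. Unital nondiscrete means containing $1$ and dense in $\mathbb R$; $\mathcal U_+=\mathcal U\cap[0,\infty)$. Square matrices $A,B$ (possibly of different sizes) are strong shift equivalent over a semiring $\mathcal S$ if there are $\ell\in\mathbb N$, square matrices $A=A_0,A_1,\dots,A_\ell=B$ and (possibly rectangular) matrices $R_i,S_i$ over $\mathcal S$ with $A_{i-1}=R_iS_i$ and $A_i=S_iR_i$ for $1\le i\le\ell$. That $W$ sends positive eigenvectors to positive eigenvectors means: if $v$ is a positive row (left) eigenvector of $A'$, then $vW$ is a positive row eigenvector of $B'$. *)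

theory Defs
  imports
    "HOL-Analysis.Elementary_Topology"
    "HOL-Algebra.Subrings"
    "Jordan_Normal_Form.VS_Connect"
    "Jordan_Normal_Form.Char_Poly"
begin

definition nondiscrete_unital_subring :: "real set \<Rightarrow> bool" where
  "nondiscrete_unital_subring U \<longleftrightarrow>
     subring U (class_ring :: real ring) \<and> closure U = UNIV"

definition nonneg_part :: "real set \<Rightarrow> real set" where
  "nonneg_part U = U \<inter> {0..}"

definition mat_over :: "'a set \<Rightarrow> 'a Matrix.mat \<Rightarrow> bool" where
  "mat_over S M \<longleftrightarrow> elements_mat M \<subseteq> S"

definition positive_mat :: "real Matrix.mat \<Rightarrow> bool" where
  "positive_mat M \<longleftrightarrow> (\<forall>x \<in> elements_mat M. 0 < x)"

definition positive_vec :: "real Matrix.vec \<Rightarrow> bool" where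
  "positive_vec v \<longleftrightarrow> (\<forall>i < dim_vec v. 0 < v $ i)"

text \<open>Square matrices in a chain have size at least 1: the type of matrices also
  contains the 0 by 0 matrix, which is not meant here. Since all \<open>M i\<close> are square over \<open>S\<close>,
  the case \<open>l = 0\<close> merely says that \<open>A = B\<close> is such a matrix.\<close>

definition strong_shift_equivalent ::
    "'a :: semiring_1 set \<Rightarrow> 'a Matrix.mat \<Rightarrow> 'a Matrix.mat \<Rightarrow> bool" where
  "strong_shift_equivalent S A B \<longleftrightarrow>
     (\<exists>(l :: nat) (M :: nat \<Rightarrow> 'a Matrix.mat) (P :: nat \<Rightarrow> 'a Matrix.mat) (Q :: nat \<Rightarrow> 'a Matrix.mat).
        M 0 = A \<and> M l = B \<and>
        (\<forall>i \<le> l. square_mat (M i) \<and> 0 < dim_row (M i) \<and> mat_over S (M i)) \<and>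
        (\<forall>i \<in> {1..l}.
           P i \<in> carrier_mat (dim_row (M (i - 1))) (dim_row (M i)) \<and> mat_over S (P i) \<and>
           Q i \<in> carrier_mat (dim_row (M i)) (dim_row (M (i - 1))) \<and> mat_over S (Q i) \<and>
           M (i - 1) = P i * Q i \<and> M i = Q i * P i))"

text \<open>\<^term>\<open>similar_mat_wit B A V W\<close> says that \<open>A\<close>, \<open>B\<close>, \<open>V\<close>, \<open>W\<close> are square of one size,
  \<open>V\<close> is the two-sided inverse of \<open>W\<close>, and \<open>B = V A W\<close>; so \<open>W\<close> is in the general linear
  group over \<open>U\<close> exactly because \<open>V\<close> has its entries in \<open>U\<close> as well.\<close>

definition conjugates_over ::
    "'a :: semiring_1 set \<Rightarrow> 'a Matrix.mat \<Rightarrow> 'a Matrix.mat \<Rightarrow> 'a Matrix.mat \<Rightarrow> bool" where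
  "conjugates_over U W A B \<longleftrightarrow>
     (\<exists>V. mat_over U W \<and> mat_over U V \<and> similar_mat_wit B A V W)"

text \<open>Vectors carry no row/column distinction, and only the product of a matrix with
  a column vector is available, so the row vector \<open>v M\<close> is computed by transposition.\<close>

definition row_mult :: "'a :: semiring_0 Matrix.vec \<Rightarrow> 'a Matrix.mat \<Rightarrow> 'a Matrix.vec" where
  "row_mult v M = transpose_mat M *\<^sub>v v"

definition row_eigenvector :: "'a :: comm_ring_1 Matrix.mat \<Rightarrow> 'a Matrix.vec \<Rightarrow> bool" where
  "row_eigenvector A v \<longleftrightarrow> (\<exists>k. eigenvector (transpose_mat A) v k)"

definition sends_positive_eigenvectors ::
    "real Matrix.mat \<Rightarrow> real Matrix.mat \<Rightarrow> real Matrix.mat \<Rightarrow> bool" where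
  "sends_positive_eigenvectors W A B \<longleftrightarrow>
     (\<forall>v. positive_vec v \<and> row_eigenvector A v \<longrightarrow>
          positive_vec (row_mult v W) \<and> row_eigenvector B (row_mult v W))"

end

theory Submission
  imports Defs "HOL-Analysis.Function_Topology"
begin

text \<open>Every elementary strong shift equivalence becomes a conjugacy after bordering by zero blocks:
if \<open>A = P Q\<close> and \<open>B = Q P\<close>, then conjugating by the unipotent matrix with off-diagonal block \<open>P\<close>
carries \<open>[A, 0; Q, 0]\<close> to \<open>[0, 0; Q, B]\<close>. The proof turns this algebra into statements about
positive matrices.

The analytic input is that bordering costs nothing for positive matrices. If \<open>A\<close> is positive over
\<open>U\<close> and \<open>Y\<close> is any block over \<open>U\<close>, then \<open>[A, 0; Y, 0]\<close> is conjugate to \<open>[A, 0; Y + Z A, 0]\<close>, so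
\<open>Y\<close> may be taken positive by choosing a large \<open>Z\<close>. By density there is a positive \<open>X\<close> over \<open>U\<close>
so small that \<open>A - X Y\<close> is positive. Then \<open>A = [I, X] [A - X Y; Y]\<close> is a factorization over the
nonnegative part of \<open>U\<close>, and the reversed product is a positive matrix conjugate to
\<open>[A, 0; Y, 0]\<close> (\<open>realize_row_extension\<close>; transposing gives \<open>realize_column_extension\<close>). Hence the
matrices \<open>M\<close> that are conjugate to a positive matrix reached from \<open>A\<close> over the nonnegative part of
\<open>U\<close>, here called \<open>realizable\<close> from \<open>A\<close>, are closed under conjugacy and under both kinds of zero
bordering.

The matrices in the middle of the given chain from \<open>A\<close> to \<open>B\<close> need not be positive, so they are
never realized themselves. Instead, along the chain, some \<open>M\<close> realizable from \<open>A\<close> is kept that is an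
iterated column bordering of the current matrix. Row borderings commute past column borderings,
so one link of the chain replaces the current matrix by the next one
(\<open>realizable_tower_step\<close>). At the end \<open>M\<close> is an iterated bordering of the positive matrix \<open>B\<close>,
and therefore it is realizable from \<open>B\<close> too (\<open>common_realization\<close>). The two realizations of \<open>M\<close>
are conjugate over \<open>U\<close>.

It remains to adjust two signs. By Perron-Frobenius theory a conjugacy between positive matrices
maps all positive eigenvectors to positive vectors or all of them to negative ones
(\<open>intertwiner_signed_on_positive_eigenvectors\<close>), and replacing \<open>W\<close> by \<open>- W\<close> repairs this. For the
determinant, \<open>M\<close> is first replaced by its direct sum with a zero: negating the extra coordinate
gives a matrix of determinant \<open>-1\<close> that commutes with the realization and fixes all its row
eigenvectors with nonzero eigenvalue (\<open>reflection_of_zero_summand\<close>).\<close>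

section \<open>Perron-Frobenius theory of positive matrices\<close>

lemma weighted_sum_pos:
  fixes c x :: "nat \<Rightarrow> real"
  assumes c: "\<And>j. j < n \<Longrightarrow> 0 < c j" and x: "\<And>j. j < n \<Longrightarrow> 0 \<le> x j" and k: "k < n" "x k \<noteq> 0"
  shows "0 < (\<Sum>j<n. c j * x j)"
proof (rule sum_pos2[of _ k])
  show "0 < c k * x k" using c[OF k(1)] x[OF k(1)] k(2) by simp
  show "0 \<le> c j * x j" if "j \<in> {..<n}" for j
    using c[of j] x[of j] that by simp
qed (use k in auto)

text \<open>The Collatz-Wielandt argument: among nonnegative vectors \<open>x\<close> of coordinate sum 1, take one
with the largest \<open>t\<close> such that \<open>c x \<ge> t x\<close>. If \<open>c x\<close> and \<open>t x\<close> differed somewhere, applying \<open>c\<close>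
once more would make the inequality for \<open>c x\<close> strict everywhere, leaving room for a larger \<open>t\<close>.
Vectors are functions on the natural numbers, so that compactness is Tychonoff's theorem and
the dimension remains a term.\<close>

lemma perron_eigenvector_fun:
  fixes c :: "nat \<Rightarrow> nat \<Rightarrow> real"
  assumes n: "0 < n" and c: "\<And>i j. i < n \<Longrightarrow> j < n \<Longrightarrow> 0 < c i j"
  shows "\<exists>x r. (\<forall>i<n. 0 < x i) \<and> 0 < r \<and> (\<forall>i<n. (\<Sum>j<n. c i j * x j) = r * x i)"
proof -
  define M where "M = (\<Sum>i<n. \<Sum>j<n. c i j)"
  \<comment> \<open>Coordinates beyond the dimension are pinned to 0, which keeps the box compact in the product topology.\<close>
  define K where "K = {0..M} \<times> (PiE UNIV (\<lambda>i. if i < n then {0..1} else {0::real}))"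
  define T where "T = {p \<in> K. (\<Sum>i<n. snd p i) = 1 \<and> (\<forall>i<n. fst p * snd p i \<le> (\<Sum>j<n. c i j * snd p j))}"
  have coord: "continuous_on UNIV (\<lambda>p::real \<times> (nat \<Rightarrow> real). snd p i)" for i
    using continuous_on_compose[OF continuous_on_snd[OF continuous_on_id]
        continuous_on_subset[OF continuous_on_product_coordinates[of i] subset_UNIV]]
    by (simp add: o_def)
  have "compact (PiE UNIV (\<lambda>i. if i < n then {0..1} else {0::real}))"
    using compactin_PiE[of "\<lambda>i. euclidean :: real topology" UNIV "\<lambda>i. if i < n then {0..1} else {0::real}"]
    by (auto simp: euclidean_product_topology)
  then have cK: "compact K" unfolding K_def by (intro compact_Times) auto
  have "closed {p :: real \<times> (nat \<Rightarrow> real). (\<Sum>i<n. snd p i) = 1 \<and> (\<forall>i\<in>{..<n}. fst p * snd p i \<le> (\<Sum>j<n. c i j * snd p j))}"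
    unfolding Collect_conj_eq Collect_ball_eq
    by (intro closed_Int closed_INT ballI closed_Collect_eq closed_Collect_le continuous_intros coord)
  moreover have "T = K \<inter> {p :: real \<times> (nat \<Rightarrow> real). (\<Sum>i<n. snd p i) = 1 \<and> (\<forall>i\<in>{..<n}. fst p * snd p i \<le> (\<Sum>j<n. c i j * snd p j))}"
    unfolding T_def by auto
  ultimately have cT: "compact T" using cK by (simp add: compact_Int_closed)
  \<comment> \<open>Any nonnegative nonzero vector satisfying the inequality competes after normalization, and the bound \<open>M\<close> on \<open>t\<close> is automatic.\<close>
  have T_I: "(t, \<lambda>i. if i < n then x i / (\<Sum>j<n. x j) else 0) \<in> T"
    if x: "\<And>i. i < n \<Longrightarrow> 0 \<le> x i" and s: "0 < (\<Sum>j<n. x j)" and t: "0 \<le> t"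
      and le: "\<And>i. i < n \<Longrightarrow> t * x i \<le> (\<Sum>j<n. c i j * x j)" for t and x :: "nat \<Rightarrow> real"
  proof -
    have le1: "x i \<le> (\<Sum>j<n. x j)" if "i < n" for i
      using that x by (intro member_le_sum) auto
    have "t * (\<Sum>i<n. x i) \<le> (\<Sum>i<n. \<Sum>j<n. c i j * x j)"
      unfolding sum_distrib_left using le by (intro sum_mono) auto
    also have "\<dots> \<le> (\<Sum>i<n. \<Sum>j<n. c i j * (\<Sum>j<n. x j))"
      using le1 c by (intro sum_mono mult_left_mono) (auto simp: less_imp_le)
    also have "\<dots> = M * (\<Sum>i<n. x i)"
      unfolding M_def sum_distrib_right ..
    finally have "t \<le> M" using s by simp
    moreover have "t * (x i / (\<Sum>j<n. x j)) \<le> (\<Sum>j<n. c i j * (if j < n then x j / (\<Sum>j<n. x j) else 0))"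
      if "i < n" for i
    proof -
      have "(\<Sum>j<n. c i j * (if j < n then x j / (\<Sum>j<n. x j) else 0)) = (\<Sum>j<n. c i j * x j) / (\<Sum>j<n. x j)"
        unfolding sum_divide_distrib by (rule sum.cong) auto
      then show ?thesis using le[OF that] s by (simp add: divide_right_mono)
    qed
    moreover have "(\<Sum>i<n. (if i < n then x i / (\<Sum>j<n. x j) else 0)) = 1"
    proof -
      have "(\<Sum>i<n. (if i < n then x i / (\<Sum>j<n. x j) else 0)) = (\<Sum>i<n. x i) / (\<Sum>j<n. x j)"
        unfolding sum_divide_distrib by (rule sum.cong) auto
      then show ?thesis using s by simp
    qed
    ultimately show ?thesis
      unfolding T_def K_def using t s x le1 by (auto simp: field_simps)
  qed
  have "0 \<le> (\<Sum>j<n. c i j)" if "i < n" for i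
    using c that by (intro sum_nonneg) (auto simp: less_imp_le)
  then have "T \<noteq> {}" using T_I[of "\<lambda>_. 1" 0] n by auto
  then obtain p where p: "p \<in> T" and max: "\<And>q. q \<in> T \<Longrightarrow> fst q \<le> fst p"
    using continuous_attains_sup[OF cT _ continuous_on_fst[OF continuous_on_id]] by auto
  define t x where "t = fst p" and "x = snd p"
  define y where "y i = (\<Sum>j<n. c i j * x j)" for i
  have x0: "0 \<le> x i" if "i < n" for i
  proof -
    have "x i \<in> {0..1}" using p that unfolding T_def K_def x_def by (auto dest!: PiE_mem[of _ _ _ i])
    then show ?thesis by simp
  qed
  have t0: "0 \<le> t" and x1: "(\<Sum>i<n. x i) = 1" and ty: "\<And>i. i < n \<Longrightarrow> t * x i \<le> y i"
    using p unfolding T_def K_def t_def x_def y_def by auto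
  obtain k where k: "k < n" "x k \<noteq> 0"
    using x1 by (metis lessThan_iff sum.neutral zero_neq_one)
  have y0: "0 < y i" if "i < n" for i
    unfolding y_def using c x0 k that by (intro weighted_sum_pos) auto
  have eq: "y i = t * x i" if i: "i < n" for i
  proof (rule ccontr)
    assume ne: "y i \<noteq> t * x i"
    \<comment> \<open>Applying \<open>c\<close> to the nonnegative, nonzero vector \<open>y - t x\<close>.\<close>
    have strict: "t * y l < (\<Sum>j<n. c l j * y j)" if l: "l < n" for l
    proof -
      have "0 < (\<Sum>j<n. c l j * (y j - t * x j))"
        using c l ty ne i by (intro weighted_sum_pos[where k = i]) auto
      also have "\<dots> = (\<Sum>j<n. c l j * y j) - t * y l"
        unfolding y_def[of l] by (simp add: right_diff_distrib sum_subtractf sum_distrib_left mult_ac)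
      finally show ?thesis by simp
    qed
    define s where "s = Min ((\<lambda>l. (\<Sum>j<n. c l j * y j) / y l) ` {..<n})"
    have "t < s" unfolding s_def using n strict y0
      by (subst Min_gr_iff) (auto simp: field_simps)
    have "s * y l \<le> (\<Sum>j<n. c l j * y j)" if "l < n" for l
    proof -
      have "s \<le> (\<Sum>j<n. c l j * y j) / y l" unfolding s_def using that by (intro Min_le) auto
      then show ?thesis using y0[OF that] by (simp add: field_simps)
    qed
    moreover have "0 < (\<Sum>j<n. y j)" using y0 n by (intro sum_pos) auto
    ultimately have "(s, \<lambda>i. if i < n then y i / (\<Sum>j<n. y j) else 0) \<in> T"
      using \<open>t < s\<close> t0 y0 by (intro T_I) (auto simp: less_imp_le)
    from max[OF this] \<open>t < s\<close> show False unfolding t_def by simp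
  qed
  have "0 < t" using eq[OF n] y0[OF n] t0 by (cases "t = 0") auto
  moreover have "0 < x i" if "i < n" for i
    using eq[OF that] y0[OF that] x0[OF that] by (cases "x i = 0") auto
  ultimately show ?thesis using eq unfolding y_def by blast
qed

text \<open>The triangle inequality gives \<open>c \<bar>x\<bar> \<ge> s \<bar>x\<bar>\<close>, and pairing with the left eigenvector \<open>p\<close> together with
\<open>r \<le> s\<close> forces equality, so \<open>\<bar>x\<bar>\<close> is an eigenvector as well. Now \<open>\<bar>x\<bar> - x\<close> is a nonnegative
eigenvector: either it vanishes, so that \<open>x\<close> is itself a nonnegative eigenvector and hence positive, or
it is strictly positive and \<open>x\<close> is negative everywhere.\<close>

lemma signed_eigenvector_fun:
  fixes c :: "nat \<Rightarrow> nat \<Rightarrow> real"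
  assumes n: "0 < n" and c: "\<And>i j. i < n \<Longrightarrow> j < n \<Longrightarrow> 0 < c i j"
    and p: "\<And>i. i < n \<Longrightarrow> 0 < p i" and left: "\<And>j. j < n \<Longrightarrow> (\<Sum>i<n. p i * c i j) = r * p j"
    and right: "\<And>i. i < n \<Longrightarrow> (\<Sum>j<n. c i j * x j) = s * x i"
    and k: "k < n" "x k \<noteq> 0" and rs: "r \<le> s"
  shows "(\<forall>i<n. 0 < x i) \<or> (\<forall>i<n. x i < 0)"
proof -
  have "0 < (\<Sum>i<n. p i * c i 0)" using p c n by (intro sum_pos) auto
  then have "0 < r" using left[OF n] p[OF n] by (simp add: zero_less_mult_iff)
  then have s: "0 < s" using rs by simp
  define d where "d i = (\<Sum>j<n. c i j * \<bar>x j\<bar>) - s * \<bar>x i\<bar>" for i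
  have d0: "0 \<le> d i" if "i < n" for i
  proof -
    have "s * \<bar>x i\<bar> = \<bar>\<Sum>j<n. c i j * x j\<bar>" using right[OF that] s by (simp add: abs_mult)
    also have "\<dots> \<le> (\<Sum>j<n. \<bar>c i j * x j\<bar>)" by (rule sum_abs)
    also have "\<dots> = (\<Sum>j<n. c i j * \<bar>x j\<bar>)" using c that
      by (intro sum.cong) (auto simp: abs_mult less_imp_le)
    finally show ?thesis unfolding d_def by simp
  qed
  have "(\<Sum>i<n. p i * d i) = (\<Sum>i<n. \<Sum>j<n. p i * c i j * \<bar>x j\<bar>) - s * (\<Sum>i<n. p i * \<bar>x i\<bar>)"
    unfolding d_def by (simp add: right_diff_distrib sum_subtractf sum_distrib_left mult_ac)
  also have "(\<Sum>i<n. \<Sum>j<n. p i * c i j * \<bar>x j\<bar>) = (\<Sum>j<n. (\<Sum>i<n. p i * c i j) * \<bar>x j\<bar>)"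
    unfolding sum_distrib_right by (rule sum.swap)
  also have "\<dots> = r * (\<Sum>i<n. p i * \<bar>x i\<bar>)"
    unfolding sum_distrib_left using left by (intro sum.cong) auto
  also have "\<dots> \<le> s * (\<Sum>i<n. p i * \<bar>x i\<bar>)"
    using rs p by (intro mult_right_mono sum_nonneg) (auto simp: less_imp_le)
  finally have "(\<Sum>i<n. p i * d i) \<le> 0" by simp
  moreover have nn: "\<And>i. i \<in> {..<n} \<Longrightarrow> 0 \<le> p i * d i" using p d0 by (simp add: less_imp_le)
  ultimately have "(\<Sum>i<n. p i * d i) = 0" using sum_nonneg[of "{..<n}" "\<lambda>i. p i * d i"] by fastforce
  then have pd: "p i * d i = 0" if "i < n" for i using sum_nonneg_eq_0_iff[of "{..<n}" "\<lambda>i. p i * d i"] nn that by auto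
  have d: "d i = 0" if "i < n" for i using pd[OF that] p[OF that] by simp
  show ?thesis
  proof (cases "\<forall>l<n. x l = \<bar>x l\<bar>")
    case True
    have "0 < x i" if "i < n" for i
    proof -
      have "0 < (\<Sum>j<n. c i j * x j)" using c that True k
        by (intro weighted_sum_pos[where k = k]) (simp_all, metis abs_ge_zero)
      then show ?thesis using right[OF that] s by (simp add: zero_less_mult_iff)
    qed
    then show ?thesis by blast
  next
    case False
    then obtain l where l: "l < n" "\<bar>x l\<bar> - x l \<noteq> 0" by auto
    have "x i < 0" if "i < n" for i
    proof -
      have "0 < (\<Sum>j<n. c i j * (\<bar>x j\<bar> - x j))" using c that l by (intro weighted_sum_pos[where k = l]) auto
      also have "\<dots> = s * (\<bar>x i\<bar> - x i)" using d[OF that] right[OF that]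
        unfolding d_def by (simp add: right_diff_distrib sum_subtractf)
      finally show ?thesis using s by (simp add: zero_less_mult_iff)
    qed
    then show ?thesis by blast
  qed
qed

text \<open>An eigenvalue with a positive eigenvector dominates all real eigenvalues. Here \<open>u\<close> is an
eigenvector of the transpose; pairing \<open>\<bar>u\<bar>\<close> with \<open>v\<close> compares the two eigenvalues.\<close>

lemma eigenvalue_le_fun:
  fixes c :: "nat \<Rightarrow> nat \<Rightarrow> real"
  assumes c: "\<And>i j. i < n \<Longrightarrow> j < n \<Longrightarrow> 0 < c i j"
    and v: "\<And>i. i < n \<Longrightarrow> 0 < v i" and right: "\<And>i. i < n \<Longrightarrow> (\<Sum>j<n. c i j * v j) = s * v i"
    and left: "\<And>j. j < n \<Longrightarrow> (\<Sum>i<n. c i j * u i) = r * u j"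
    and k: "k < n" "u k \<noteq> 0"
  shows "r \<le> s"
proof -
  have pos: "0 < (\<Sum>j<n. v j * \<bar>u j\<bar>)" using v k by (intro weighted_sum_pos[where k = k]) auto
  have "r * (\<Sum>j<n. v j * \<bar>u j\<bar>) \<le> (\<Sum>j<n. v j * (\<Sum>i<n. c i j * \<bar>u i\<bar>))"
    unfolding sum_distrib_left[of r]
  proof (rule sum_mono)
    fix j assume "j \<in> {..<n}" then have j: "j < n" by simp
    have "r * \<bar>u j\<bar> \<le> \<bar>r * u j\<bar>" by (simp add: abs_mult mult_right_mono)
    also have "\<dots> \<le> (\<Sum>i<n. \<bar>c i j * u i\<bar>)" unfolding left[OF j, symmetric] by (rule sum_abs)
    also have "\<dots> = (\<Sum>i<n. c i j * \<bar>u i\<bar>)" using c j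
      by (intro sum.cong) (auto simp: abs_mult less_imp_le)
    finally show "r * (v j * \<bar>u j\<bar>) \<le> v j * (\<Sum>i<n. c i j * \<bar>u i\<bar>)"
      using v[OF j] by (simp add: mult.left_commute[of r])
  qed
  also have "\<dots> = (\<Sum>i<n. \<Sum>j<n. c i j * v j * \<bar>u i\<bar>)"
    unfolding sum_distrib_left by (subst sum.swap) (simp add: mult_ac)
  also have "\<dots> = (\<Sum>i<n. s * v i * \<bar>u i\<bar>)"
    unfolding sum_distrib_right[symmetric] using right by (intro sum.cong) auto
  also have "\<dots> = s * (\<Sum>j<n. v j * \<bar>u j\<bar>)" by (simp add: sum_distrib_left mult_ac)
  finally show ?thesis using pos by simp
qed

lemma mat_over_iff:
  "mat_over S M \<longleftrightarrow> (\<forall>i < dim_row M. \<forall>j < dim_col M. M $$ (i, j) \<in> S)"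
  unfolding mat_over_def by auto

lemma positive_mat_iff:
  "positive_mat M \<longleftrightarrow> (\<forall>i < dim_row M. \<forall>j < dim_col M. 0 < M $$ (i, j))"
  unfolding positive_mat_def using elements_matI[OF carrier_matI[OF refl refl], of _ M] by blast

lemma positive_mat_transpose [simp]: "positive_mat (transpose_mat M) \<longleftrightarrow> positive_mat M"
  unfolding positive_mat_iff by auto

lemma mult_mat_vec_index_sum:
  "A \<in> carrier_mat m n \<Longrightarrow> x \<in> carrier_vec n \<Longrightarrow> i < m \<Longrightarrow> (A *\<^sub>v x) $ i = (\<Sum>j<n. A $$ (i, j) * x $ j)"
  by (simp add: scalar_prod_def atLeast0LessThan)

lemma perron_eigenvector:
  assumes A: "A \<in> carrier_mat n n" "positive_mat A" and n: "0 < n"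
  shows "\<exists>x \<in> carrier_vec n. \<exists>r. positive_vec x \<and> A *\<^sub>v x = r \<cdot>\<^sub>v x"
proof -
  obtain x r where x: "\<forall>i<n. 0 < x i" and eq: "\<forall>i<n. (\<Sum>j<n. A $$ (i, j) * x j) = r * x i"
    using perron_eigenvector_fun[OF n, of "\<lambda>i j. A $$ (i, j)"] A unfolding positive_mat_iff by auto
  have "A *\<^sub>v vec n x = r \<cdot>\<^sub>v vec n x"
    using A eq by (intro eq_vecI) (auto simp: mult_mat_vec_index_sum simp del: index_mult_mat_vec)
  then show ?thesis using x by (intro bexI[of _ "vec n x"]) (auto simp: positive_vec_def)
qed

lemma nonzero_vec_entry:
  assumes "x \<in> carrier_vec n" "x \<noteq> 0\<^sub>v n"
  obtains k where "k < n" "x $ k \<noteq> 0"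
  using assms by (metis carrier_vecD eq_vecI index_zero_vec(1) zero_carrier_vec)

lemma eigen_index_sum:
  assumes "A \<in> carrier_mat n n" "x \<in> carrier_vec n" "A *\<^sub>v x = r \<cdot>\<^sub>v x" "i < n"
  shows "(\<Sum>j<n. A $$ (i, j) * x $ j) = r * x $ i"
  using mult_mat_vec_index_sum[OF assms(1,2,4)] assms by auto

lemma signed_eigenvector:
  assumes C: "C \<in> carrier_mat n n" "positive_mat C"
    and p: "p \<in> carrier_vec n" "positive_vec p" "transpose_mat C *\<^sub>v p = r \<cdot>\<^sub>v p"
    and x: "x \<in> carrier_vec n" "x \<noteq> 0\<^sub>v n" "C *\<^sub>v x = s \<cdot>\<^sub>v x" and rs: "r \<le> s"
  shows "positive_vec x \<or> positive_vec (- x)"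
proof -
  obtain k where k: "k < n" "x $ k \<noteq> 0" using nonzero_vec_entry[OF x(1,2)] .
  have "(\<Sum>i<n. p $ i * C $$ (i, j)) = r * p $ j" if "j < n" for j
    using eigen_index_sum[of "transpose_mat C" n p r j] C p that by (simp add: mult.commute)
  then have "(\<forall>i<n. 0 < x $ i) \<or> (\<forall>i<n. x $ i < 0)"
    using C p k rs eigen_index_sum[OF C(1) x(1,3)]
    by (intro signed_eigenvector_fun[where c = "\<lambda>i j. C $$ (i, j)" and p = "\<lambda>i. p $ i" and r = r and s = s])
      (auto simp: positive_mat_iff positive_vec_def)
  then show ?thesis using x unfolding positive_vec_def by auto
qed

lemma eigenvalue_le:
  assumes C: "C \<in> carrier_mat n n" "positive_mat C"
    and v: "v \<in> carrier_vec n" "positive_vec v" "C *\<^sub>v v = s \<cdot>\<^sub>v v"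
    and u: "u \<in> carrier_vec n" "u \<noteq> 0\<^sub>v n" "transpose_mat C *\<^sub>v u = r \<cdot>\<^sub>v u"
  shows "r \<le> s"
proof -
  obtain k where k: "k < n" "u $ k \<noteq> 0" using nonzero_vec_entry[OF u(1,2)] .
  have "(\<Sum>i<n. C $$ (i, j) * u $ i) = r * u $ j" if "j < n" for j
    using eigen_index_sum[of "transpose_mat C" n u r j] C u that by simp
  then show ?thesis
    using C v k eigen_index_sum[OF C(1) v(1,3)]
    by (intro eigenvalue_le_fun[where c = "\<lambda>i j. C $$ (i, j)" and v = "\<lambda>i. v $ i" and u = "\<lambda>i. u $ i" and r = r and s = s])
      (auto simp: positive_mat_iff positive_vec_def)
qed

lemma scalar_prod_pos:
  fixes x y :: "real Matrix.vec"
  assumes "x \<in> carrier_vec n" "y \<in> carrier_vec n" "0 < n" "positive_vec x" "positive_vec y"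
  shows "0 < x \<bullet> y"
  using assms unfolding scalar_prod_def positive_vec_def by (intro sum_pos) auto

lemma invertible_mult_vec_nonzero:
  fixes W V :: "real Matrix.mat"
  assumes "W \<in> carrier_mat n n" "V \<in> carrier_mat n n" "V * W = 1\<^sub>m n"
    and "x \<in> carrier_vec n" "x \<noteq> 0\<^sub>v n"
  shows "W *\<^sub>v x \<noteq> 0\<^sub>v n"
proof
  assume "W *\<^sub>v x = 0\<^sub>v n"
  then have "V *\<^sub>v (W *\<^sub>v x) = 0\<^sub>v n" using assms(2) by (intro eq_vecI) auto
  moreover have "V *\<^sub>v (W *\<^sub>v x) = x"
    using assms assoc_mult_mat_vec[of V n n W n x] by simp
  ultimately show False using assms(5) by simp
qed

lemma intertwined_eigenvector:
  fixes P Q W :: "real Matrix.mat"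
  assumes c: "P \<in> carrier_mat n n" "Q \<in> carrier_mat n n" "W \<in> carrier_mat n n" and eq: "Q * W = W * P"
    and v: "v \<in> carrier_vec n" "P *\<^sub>v v = k \<cdot>\<^sub>v v"
  shows "Q *\<^sub>v (W *\<^sub>v v) = k \<cdot>\<^sub>v (W *\<^sub>v v)"
proof -
  have "Q *\<^sub>v (W *\<^sub>v v) = (Q * W) *\<^sub>v v" using c v by simp
  also have "\<dots> = W *\<^sub>v (P *\<^sub>v v)" unfolding eq using c v by simp
  also have "\<dots> = k \<cdot>\<^sub>v (W *\<^sub>v v)" unfolding v(2) using c v by (simp add: mult_mat_vec)
  finally show ?thesis .
qed

text \<open>Let \<open>p\<close> be a Perron vector of the transpose of \<open>Q\<close>, and \<open>u\<close> its image under the transpose of \<open>W\<close>. If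
\<open>P\<close> has a positive eigenvector \<open>v\<close>, the eigenvalues of \<open>v\<close> and \<open>p\<close> dominate each other, so they
agree and both \<open>u\<close> and \<open>W v\<close> have constant strict sign. The pairing of \<open>p\<close> with \<open>W v\<close> equals that of
\<open>u\<close> with \<open>v\<close>, so the sign of \<open>W v\<close> is the sign of \<open>u\<close>, which is the same for all \<open>v\<close>.\<close>

lemma intertwiner_signed_on_positive_eigenvectors:
  assumes n: "0 < n" and P: "P \<in> carrier_mat n n" "positive_mat P" and Q: "Q \<in> carrier_mat n n" "positive_mat Q"
    and W: "W \<in> carrier_mat n n" and V: "V \<in> carrier_mat n n" "V * W = 1\<^sub>m n" "W * V = 1\<^sub>m n"
    and eq: "Q * W = W * P"
  shows "(\<forall>v \<in> carrier_vec n. \<forall>k. positive_vec v \<and> P *\<^sub>v v = k \<cdot>\<^sub>v v \<longrightarrow> positive_vec (W *\<^sub>v v)) \<or>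
         (\<forall>v \<in> carrier_vec n. \<forall>k. positive_vec v \<and> P *\<^sub>v v = k \<cdot>\<^sub>v v \<longrightarrow> positive_vec (- (W *\<^sub>v v)))"
proof -
  obtain p r where p: "p \<in> carrier_vec n" "positive_vec p" "transpose_mat Q *\<^sub>v p = r \<cdot>\<^sub>v p"
    using perron_eigenvector[of "transpose_mat Q" n] Q n by auto
  have nz: "x \<noteq> 0\<^sub>v n" if "x \<in> carrier_vec n" "positive_vec x" for x
    using that n unfolding positive_vec_def by auto
  define u where "u = transpose_mat W *\<^sub>v p"
  have uc: "u \<in> carrier_vec n" unfolding u_def using W p by auto
  have "transpose_mat V * transpose_mat W = 1\<^sub>m n"
    using V W by (metis transpose_mult transpose_one)
  then have un: "u \<noteq> 0\<^sub>v n"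
    unfolding u_def using W V p nz by (intro invertible_mult_vec_nonzero[where V = "transpose_mat V"]) auto
  have "transpose_mat P * transpose_mat W = transpose_mat W * transpose_mat Q"
    using eq W P Q by (metis transpose_mult)
  then have ue: "transpose_mat P *\<^sub>v u = r \<cdot>\<^sub>v u"
    unfolding u_def using P Q W p by (intro intertwined_eigenvector) auto
  have image: "positive_vec u \<or> positive_vec (- u)" "positive_vec (W *\<^sub>v v) \<or> positive_vec (- (W *\<^sub>v v))"
    and pairing: "p \<bullet> (W *\<^sub>v v) = u \<bullet> v"
    if v: "v \<in> carrier_vec n" "positive_vec v" "P *\<^sub>v v = k \<cdot>\<^sub>v v" for v k
  proof -
    define x where "x = W *\<^sub>v v"
    have xc: "x \<in> carrier_vec n" unfolding x_def using W v by auto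
    have xn: "x \<noteq> 0\<^sub>v n" unfolding x_def using W V v nz by (intro invertible_mult_vec_nonzero[where V = V]) auto
    have xe: "Q *\<^sub>v x = k \<cdot>\<^sub>v x" unfolding x_def using P Q W eq v by (intro intertwined_eigenvector) auto
    have "r \<le> k" using eigenvalue_le[OF P v uc un ue] .
    have "k \<le> r" using eigenvalue_le[of "transpose_mat Q" n p r x k] Q p xc xn xe by simp
    show "positive_vec (W *\<^sub>v v) \<or> positive_vec (- (W *\<^sub>v v))"
      using signed_eigenvector[OF Q p xc xn xe \<open>r \<le> k\<close>] unfolding x_def .
    show "positive_vec u \<or> positive_vec (- u)"
      using signed_eigenvector[of "transpose_mat P" n v k u r] P v uc un ue \<open>k \<le> r\<close> by simp
    show "p \<bullet> (W *\<^sub>v v) = u \<bullet> v"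
      unfolding u_def using W p v by (simp add: transpose_vec_mult_scalar)
  qed
  have neg: "y \<bullet> - x = - (y \<bullet> x)" "- x \<bullet> y = - (x \<bullet> y)" if "x \<in> carrier_vec n" "y \<in> carrier_vec n" for x y :: "real Matrix.vec"
    using that by auto
  show ?thesis
  proof (cases "positive_vec u")
    case True
    have "positive_vec (W *\<^sub>v v)" if v: "v \<in> carrier_vec n" "positive_vec v" "P *\<^sub>v v = k \<cdot>\<^sub>v v" for v k
    proof (rule ccontr)
      assume "\<not> positive_vec (W *\<^sub>v v)"
      then have "0 < p \<bullet> - (W *\<^sub>v v)" using image(2)[OF v] W v p n by (intro scalar_prod_pos) auto
      moreover have "0 < u \<bullet> v" using True v uc n by (intro scalar_prod_pos) auto
      moreover have "p \<bullet> - (W *\<^sub>v v) = - (p \<bullet> (W *\<^sub>v v))" using neg W v p by auto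
      ultimately show False using pairing[OF v] by simp
    qed
    then show ?thesis by blast
  next
    case False
    have "positive_vec (- (W *\<^sub>v v))" if v: "v \<in> carrier_vec n" "positive_vec v" "P *\<^sub>v v = k \<cdot>\<^sub>v v" for v k
    proof (rule ccontr)
      assume "\<not> positive_vec (- (W *\<^sub>v v))"
      then have "0 < p \<bullet> (W *\<^sub>v v)" using image(2)[OF v] W v p n by (intro scalar_prod_pos) auto
      moreover have "0 < - u \<bullet> v" using False image(1)[OF v] v uc n by (intro scalar_prod_pos) auto
      moreover have "- u \<bullet> v = - (u \<bullet> v)" using neg uc v by auto
      ultimately show False using pairing[OF v] by simp
    qed
    then show ?thesis by blast
  qed
qed

section \<open>Strong shift equivalence as a chain of elementary steps\<close>

lemma index_mult_mat_sum:
  "A \<in> carrier_mat m n \<Longrightarrow> B \<in> carrier_mat n k \<Longrightarrow> i < m \<Longrightarrow> j < k \<Longrightarrow>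
    (A * B) $$ (i, j) = (\<Sum>l<n. A $$ (i, l) * B $$ (l, j))"
  by (simp add: scalar_prod_def atLeast0LessThan)

definition elementary_sse :: "'a :: semiring_1 set \<Rightarrow> 'a Matrix.mat \<Rightarrow> 'a Matrix.mat \<Rightarrow> bool" where
  "elementary_sse S A B \<longleftrightarrow> (\<exists>n m P Q. 0 < n \<and> 0 < m \<and> A \<in> carrier_mat n n \<and> B \<in> carrier_mat m m \<and>
     P \<in> carrier_mat n m \<and> Q \<in> carrier_mat m n \<and> mat_over S P \<and> mat_over S Q \<and>
     mat_over S A \<and> mat_over S B \<and> A = P * Q \<and> B = Q * P)"

lemma strong_shift_equivalent_refl:
  assumes "A \<in> carrier_mat n n" "0 < n" "mat_over S A"
  shows "strong_shift_equivalent S A A"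
  unfolding strong_shift_equivalent_def
  by (rule exI[of _ 0], rule exI[of _ "\<lambda>_. A"]) (use assms in auto)

lemma strong_shift_equivalent_snoc:
  assumes AB: "strong_shift_equivalent S A B" and BC: "elementary_sse S B C"
  shows "strong_shift_equivalent S A C"
proof -
  obtain l :: nat and M P Q where M: "M 0 = A" "M l = B"
    and sq: "\<And>i. i \<le> l \<Longrightarrow> square_mat (M i) \<and> 0 < dim_row (M i) \<and> mat_over S (M i)"
    and step: "\<And>i. i \<in> {1..l} \<Longrightarrow>
           P i \<in> carrier_mat (dim_row (M (i - 1))) (dim_row (M i)) \<and> mat_over S (P i) \<and>
           Q i \<in> carrier_mat (dim_row (M i)) (dim_row (M (i - 1))) \<and> mat_over S (Q i) \<and>
           M (i - 1) = P i * Q i \<and> M i = Q i * P i"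
    using AB unfolding strong_shift_equivalent_def by blast
  obtain n m p q where BC: "0 < n" "0 < m" "B \<in> carrier_mat n n" "C \<in> carrier_mat m m"
     "p \<in> carrier_mat n m" "q \<in> carrier_mat m n" "mat_over S p" "mat_over S q"
     "mat_over S B" "mat_over S C" "B = p * q" "C = q * p"
    using BC unfolding elementary_sse_def by blast
  define M' P' Q' where "M' = M(Suc l := C)" and "P' = P(Suc l := p)" and "Q' = Q(Suc l := q)"
  have "square_mat (M' i) \<and> 0 < dim_row (M' i) \<and> mat_over S (M' i)" if "i \<le> Suc l" for i
    using that sq[of i] BC unfolding M'_def by (cases "i = Suc l") auto
  moreover have "P' i \<in> carrier_mat (dim_row (M' (i - 1))) (dim_row (M' i)) \<and> mat_over S (P' i) \<and>
           Q' i \<in> carrier_mat (dim_row (M' i)) (dim_row (M' (i - 1))) \<and> mat_over S (Q' i) \<and>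
           M' (i - 1) = P' i * Q' i \<and> M' i = Q' i * P' i" if "i \<in> {1..Suc l}" for i
  proof (cases "i = Suc l")
    case True
    then show ?thesis using BC M unfolding M'_def P'_def Q'_def by auto
  next
    case False
    then have "i \<in> {1..l}" "i \<noteq> Suc l" "i - 1 \<noteq> Suc l" using that by auto
    then have eqs: "M' i = M i" "M' (i - 1) = M (i - 1)" "P' i = P i" "Q' i = Q i"
      unfolding M'_def P'_def Q'_def by simp_all
    show ?thesis unfolding eqs by (rule step) fact
  qed
  moreover have "M' 0 = A" "M' (Suc l) = C" using M unfolding M'_def by auto
  ultimately show ?thesis unfolding strong_shift_equivalent_def by blast
qed

lemma strong_shift_equivalent_induct:
  assumes AB: "strong_shift_equivalent S A B" and base: "P A"
    and step: "\<And>C D. P C \<Longrightarrow> elementary_sse S C D \<Longrightarrow> P D"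
  shows "P B"
proof -
  obtain l :: nat and M R Q where M: "M 0 = A" "M l = B"
    and sq: "\<And>i. i \<le> l \<Longrightarrow> square_mat (M i) \<and> 0 < dim_row (M i) \<and> mat_over S (M i)"
    and chain: "\<And>i. i \<in> {1..l} \<Longrightarrow>
           R i \<in> carrier_mat (dim_row (M (i - 1))) (dim_row (M i)) \<and> mat_over S (R i) \<and>
           Q i \<in> carrier_mat (dim_row (M i)) (dim_row (M (i - 1))) \<and> mat_over S (Q i) \<and>
           M (i - 1) = R i * Q i \<and> M i = Q i * R i"
    using AB unfolding strong_shift_equivalent_def by blast
  have "P (M i)" if "i \<le> l" for i
    using that
  proof (induction i)
    case 0
    then show ?case using base M by simp
  next
    case (Suc i)
    have *: "N \<in> carrier_mat (dim_row N) (dim_row N)" if "square_mat N" for N :: "'a Matrix.mat"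
      using that by (intro carrier_matI) auto
    have "elementary_sse S (M i) (M (Suc i))"
      unfolding elementary_sse_def
    proof (rule exI[of _ "dim_row (M i)"], rule exI[of _ "dim_row (M (Suc i))"],
        rule exI[of _ "R (Suc i)"], rule exI[of _ "Q (Suc i)"], intro conjI)
      have "Suc i \<in> {1..l}" using Suc.prems by simp
      note c = chain[OF this, unfolded diff_Suc_1]
      show "R (Suc i) \<in> carrier_mat (dim_row (M i)) (dim_row (M (Suc i)))"
        "Q (Suc i) \<in> carrier_mat (dim_row (M (Suc i))) (dim_row (M i))"
        "mat_over S (R (Suc i))" "mat_over S (Q (Suc i))" "M i = R (Suc i) * Q (Suc i)" "M (Suc i) = Q (Suc i) * R (Suc i)"
        using c by blast+
      have "i \<le> l" using Suc.prems by simp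
      from sq[OF this] sq[OF Suc.prems]
      show "0 < dim_row (M i)" "mat_over S (M i)" "0 < dim_row (M (Suc i))" "mat_over S (M (Suc i))"
        "M i \<in> carrier_mat (dim_row (M i)) (dim_row (M i))"
        "M (Suc i) \<in> carrier_mat (dim_row (M (Suc i))) (dim_row (M (Suc i)))"
        using * by blast+
    qed
    then show ?case using Suc step by auto
  qed
  then show ?thesis using M by auto
qed

lemma strong_shift_equivalentD:
  assumes "strong_shift_equivalent S A B"
  shows "square_mat A" "0 < dim_row A" "square_mat B" "0 < dim_row B"
  using assms unfolding strong_shift_equivalent_def by (metis le0, metis le0, metis order_refl, metis order_refl)

text \<open>Transposition exchanges the two factors and their order; it reduces column borderings to
row borderings.\<close>

lemma elementary_sse_transpose:
  fixes A B :: "'a :: comm_semiring_1 Matrix.mat"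
  assumes "elementary_sse S A B" shows "elementary_sse S (transpose_mat A) (transpose_mat B)"
proof -
  obtain n m P Q where *: "0 < n" "0 < m" "A \<in> carrier_mat n n" "B \<in> carrier_mat m m"
     "P \<in> carrier_mat n m" "Q \<in> carrier_mat m n" "mat_over S P" "mat_over S Q"
     "mat_over S A" "mat_over S B" "A = P * Q" "B = Q * P"
    using assms unfolding elementary_sse_def by blast
  have eq: "transpose_mat A = transpose_mat Q * transpose_mat P" "transpose_mat B = transpose_mat P * transpose_mat Q"
    unfolding *(11,12) using *(5,6) by (simp_all add: transpose_mult[of _ n m _ n] transpose_mult[of _ m n _ m])
  have t: "mat_over S (transpose_mat M)" if "mat_over S M" for M
    using that unfolding mat_over_iff by simp
  show ?thesis
    unfolding elementary_sse_def
    by (rule exI[of _ n], rule exI[of _ m], rule exI[of _ "transpose_mat Q"], rule exI[of _ "transpose_mat P"],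
        intro conjI transpose_carrier_mat[THEN iffD2] t *(1-10) eq)
qed

section \<open>Conjugacy of matrices over a dense subring\<close>

lemma archimedean_finite:
  fixes f g :: "'i \<Rightarrow> real"
  assumes I: "finite I" and f: "\<And>i. i \<in> I \<Longrightarrow> 0 < f i"
  shows "\<exists>N::nat. 0 < N \<and> (\<forall>i\<in>I. g i < real N * f i)"
proof -
  obtain N where N: "(\<Sum>i\<in>I. \<bar>g i\<bar> / f i) < real N" using reals_Archimedean2 by blast
  have nn: "0 \<le> \<bar>g i\<bar> / f i" if "i \<in> I" for i using f[OF that] by simp
  then have "0 < N" using N sum_nonneg[of I "\<lambda>i. \<bar>g i\<bar> / f i"] by (cases N) auto
  moreover have "g i < real N * f i" if "i \<in> I" for i
  proof -
    have "\<bar>g i\<bar> / f i < real N"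
      using member_le_sum[OF that _ I, of "\<lambda>i. \<bar>g i\<bar> / f i"] nn N by fastforce
    then have "\<bar>g i\<bar> < real N * f i" using f[OF that] by (simp add: field_simps)
    then show ?thesis by simp
  qed
  ultimately show ?thesis by blast
qed

locale dense_real_subring =
  fixes U :: "real set"
  assumes zero_in: "0 \<in> U" and one_in: "1 \<in> U"
    and add_in: "x \<in> U \<Longrightarrow> y \<in> U \<Longrightarrow> x + y \<in> U"
    and mult_in: "x \<in> U \<Longrightarrow> y \<in> U \<Longrightarrow> x * y \<in> U"
    and uminus_in: "x \<in> U \<Longrightarrow> - x \<in> U"
    and small_in: "0 < e \<Longrightarrow> \<exists>x\<in>U. 0 < x \<and> x < e"
begin

lemma minus_in: "x \<in> U \<Longrightarrow> y \<in> U \<Longrightarrow> x - y \<in> U"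
  using add_in[of x "- y"] uminus_in by simp

lemma sum_in: "(\<And>i. i \<in> I \<Longrightarrow> f i \<in> U) \<Longrightarrow> sum f I \<in> U"
  by (induction I rule: infinite_finite_induct) (auto intro: zero_in add_in)

lemma of_nat_in: "real k \<in> U"
  by (induction k) (auto intro: zero_in one_in add_in)

lemma mat_over_mult:
  "mat_over U A \<Longrightarrow> mat_over U B \<Longrightarrow> dim_col A = dim_row B \<Longrightarrow> mat_over U (A * B)"
  unfolding mat_over_iff by (auto simp: scalar_prod_def intro!: sum_in mult_in)

lemma mat_over_simps [simp]:
  "mat_over U (0\<^sub>m n m)" "mat_over U (1\<^sub>m n)"
  "mat_over U (transpose_mat A) \<longleftrightarrow> mat_over U A"
  unfolding mat_over_iff by (auto simp: zero_in one_in)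

lemma mat_over_arith:
  "mat_over U A \<Longrightarrow> mat_over U B \<Longrightarrow> dim_row A = dim_row B \<Longrightarrow> dim_col A = dim_col B \<Longrightarrow> mat_over U (A + B)"
  "mat_over U A \<Longrightarrow> mat_over U B \<Longrightarrow> dim_row A = dim_row B \<Longrightarrow> dim_col A = dim_col B \<Longrightarrow> mat_over U (A - B)"
  "mat_over U A \<Longrightarrow> mat_over U (- A)"
  unfolding mat_over_iff by (auto intro: add_in minus_in uminus_in)

lemma mat_over_four_block:
  assumes "A \<in> carrier_mat nr1 nc1" "B \<in> carrier_mat nr1 nc2" "C \<in> carrier_mat nr2 nc1" "D \<in> carrier_mat nr2 nc2"
    and "mat_over U A" "mat_over U B" "mat_over U C" "mat_over U D"
  shows "mat_over U (four_block_mat A B C D)"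
  using elements_four_block_mat[OF assms(1-4)] assms(5-8) unfolding mat_over_def by blast

definition similar_over :: "real Matrix.mat \<Rightarrow> real Matrix.mat \<Rightarrow> bool" where
  "similar_over A B \<longleftrightarrow> (\<exists>W. conjugates_over U W A B)"

lemma similar_overI:
  assumes "similar_mat_wit B A V W" "mat_over U V" "mat_over U W"
  shows "similar_over A B"
  using assms unfolding similar_over_def conjugates_over_def by blast

lemma similar_overE:
  assumes "similar_over A B" "A \<in> carrier_mat n n"
  obtains V W where "similar_mat_wit B A V W" "mat_over U V" "mat_over U W"
    "V \<in> carrier_mat n n" "W \<in> carrier_mat n n" "B \<in> carrier_mat n n"
    "V * W = 1\<^sub>m n" "W * V = 1\<^sub>m n" "B = V * A * W"
proof -
  obtain V W where *: "similar_mat_wit B A V W" "mat_over U V" "mat_over U W"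
    using assms unfolding similar_over_def conjugates_over_def by blast
  from similar_mat_witD2[OF assms(2) similar_mat_wit_sym[OF *(1)]] similar_mat_witD(3)[OF refl *(1)]
  show ?thesis by (intro that[OF *]) auto
qed

text \<open>Checking \<open>A W = W B\<close> avoids computing triple products of block matrices.\<close>

lemma similar_over_intertwinerI:
  assumes "A \<in> carrier_mat n n" "B \<in> carrier_mat n n" "W \<in> carrier_mat n n" "V \<in> carrier_mat n n"
    and "V * W = 1\<^sub>m n" "W * V = 1\<^sub>m n" "mat_over U V" "mat_over U W" and eq: "A * W = W * B"
  shows "similar_over A B"
proof (rule similar_overI)
  have "V * A * W = V * (W * B)" using assms assoc_mult_mat[of V n n A n W n] by simp
  also have "\<dots> = (V * W) * B" using assms by (intro assoc_mult_mat[symmetric]) auto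
  finally have "V * A * W = B" using assms by simp
  then show "similar_mat_wit B A V W"
    using assms by (intro similar_mat_witI[of _ _ n]) auto
qed fact+

lemma similar_over_refl: "A \<in> carrier_mat n n \<Longrightarrow> similar_over A A"
  by (rule similar_overI[OF similar_mat_wit_refl]) auto

lemma similar_over_sym:
  assumes "similar_over A B" shows "similar_over B A"
  using assms similar_mat_wit_sym unfolding similar_over_def conjugates_over_def by blast

lemma similar_over_trans [trans]:
  assumes AB: "similar_over A B" and BC: "similar_over B C"
  shows "similar_over A C"
proof -
  obtain V W where 1: "similar_mat_wit B A V W" "mat_over U V" "mat_over U W"
    using AB unfolding similar_over_def conjugates_over_def by blast
  obtain V' W' where 2: "similar_mat_wit C B V' W'" "mat_over U V'" "mat_over U W'"
    using BC unfolding similar_over_def conjugates_over_def by blast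
  have "B \<in> carrier_mat (dim_row B) (dim_row B)" by (rule similar_mat_witD(4)[OF refl 1(1)])
  then obtain n where B: "B \<in> carrier_mat n n" by blast
  note c = similar_mat_witD2(6,7)[OF B 1(1)] similar_mat_witD2(6,7)[OF B similar_mat_wit_sym[OF 2(1)]]
  have "mat_over U (V' * V)" "mat_over U (W * W')"
    using 1(2,3) 2(2,3) c by (intro mat_over_mult; simp)+
  then show ?thesis by (rule similar_overI[OF similar_mat_wit_trans[OF 2(1) 1(1)]])
qed

lemma similar_over_transpose:
  assumes "similar_over A B" shows "similar_over (transpose_mat A) (transpose_mat B)"
proof -
  obtain V W where w: "similar_mat_wit B A V W" "mat_over U V" "mat_over U W"
    using assms unfolding similar_over_def conjugates_over_def by blast
  have "B \<in> carrier_mat (dim_row B) (dim_row B)" by (rule similar_mat_witD(4)[OF refl w(1)])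
  then obtain n where B: "B \<in> carrier_mat n n" by blast
  note d = similar_mat_witD2[OF B w(1)]
  have "transpose_mat (V * A * W) = transpose_mat W * (transpose_mat A * transpose_mat V)"
    using d(4-7) by (simp add: transpose_mult[of _ n n _ n])
  also have "\<dots> = transpose_mat W * transpose_mat A * transpose_mat V"
    using d(4-7) by (intro assoc_mult_mat[symmetric]) auto
  finally have eq: "transpose_mat B = transpose_mat W * transpose_mat A * transpose_mat V"
    unfolding d(3)[symmetric] .
  have "similar_mat_wit (transpose_mat B) (transpose_mat A) (transpose_mat W) (transpose_mat V)"
    using d(1,2,4-7) eq by (intro similar_mat_witI[of _ _ n]) (simp_all add: transpose_mult[of _ n n _ n, symmetric])
  then show ?thesis by (rule similar_overI) (use w in simp_all)
qed

lemma uminus_zero_mat: "- 0\<^sub>m n m = (0\<^sub>m n m :: real Matrix.mat)"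
  by (rule eq_matI) auto

text \<open>The hypotheses are the four block equations of the intertwining relation for
\<open>W = [I, X; 0, I]\<close>, the lower left one having been used to identify both blocks \<open>Y\<close>.\<close>

lemma similar_over_upper_unipotent:
  assumes c: "P \<in> carrier_mat n n" "P' \<in> carrier_mat n n" "X \<in> carrier_mat n m" "Q \<in> carrier_mat n m" "Q' \<in> carrier_mat n m"
      "Y \<in> carrier_mat m n" "T \<in> carrier_mat m m" "T' \<in> carrier_mat m m"
    and X: "mat_over U X" and eq: "P' = P + X * Y" "Q + X * T = P' * X + Q'" "T = Y * X + T'"
  shows "similar_over (four_block_mat P' Q' Y T') (four_block_mat P Q Y T)"
proof (rule similar_over_intertwinerI)
  let ?W = "four_block_mat (1\<^sub>m n) X (0\<^sub>m m n) (1\<^sub>m m)"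
  let ?V = "four_block_mat (1\<^sub>m n) (- X) (0\<^sub>m m n) (1\<^sub>m m)"
  note [simp] = uminus_zero_mat mult_four_block_mat[of _ n n _ m _ m _ _ n _ m]
  show "mat_over U ?V" "mat_over U ?W"
    using c X by (intro mat_over_four_block[of _ n n _ m _ m]; auto intro: mat_over_arith)+
  have "- X + X = 0\<^sub>m n m" "X + - X = 0\<^sub>m n m" using c by (auto intro!: eq_matI)
  then show "?V * ?W = 1\<^sub>m (n + m)" "?W * ?V = 1\<^sub>m (n + m)"
    using c by (simp_all add: comm_add_mat[of X n m])
  show "four_block_mat P' Q' Y T' * ?W = ?W * four_block_mat P Q Y T"
    using c eq by simp
qed (use c in auto)

text \<open>Conjugation by \<open>[I, 0; Z, I]\<close>. It makes the bordering block matter only modulo \<open>Z A\<close>, which is what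
allows a positive representative.\<close>

lemma similar_over_row_shift:
  assumes c: "A \<in> carrier_mat n n" "Y \<in> carrier_mat m n" "Z \<in> carrier_mat m n" and Z: "mat_over U Z"
  shows "similar_over (four_block_mat A (0\<^sub>m n m) (Y + Z * A) (0\<^sub>m m m)) (four_block_mat A (0\<^sub>m n m) Y (0\<^sub>m m m))"
proof (rule similar_over_intertwinerI)
  let ?W = "four_block_mat (1\<^sub>m n) (0\<^sub>m n m) Z (1\<^sub>m m)"
  let ?V = "four_block_mat (1\<^sub>m n) (0\<^sub>m n m) (- Z) (1\<^sub>m m)"
  note [simp] = uminus_zero_mat mult_four_block_mat[of _ n n _ m _ m _ _ n _ m]
  show "mat_over U ?V" "mat_over U ?W"
    using c Z by (intro mat_over_four_block[of _ n n _ m _ m]; auto intro: mat_over_arith)+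
  have "- Z + Z = 0\<^sub>m m n" "Z + - Z = 0\<^sub>m m n" using c by (auto intro!: eq_matI)
  then show "?V * ?W = 1\<^sub>m (n + m)" "?W * ?V = 1\<^sub>m (n + m)"
    using c by simp_all
  show "four_block_mat A (0\<^sub>m n m) (Y + Z * A) (0\<^sub>m m m) * ?W = ?W * four_block_mat A (0\<^sub>m n m) Y (0\<^sub>m m m)"
    using c comm_add_mat[of Y m n "Z * A"] by simp
qed (use c in auto)

lemma similar_over_block_swap:
  assumes c: "A \<in> carrier_mat n n" "B \<in> carrier_mat n m" "C \<in> carrier_mat m n" "D \<in> carrier_mat m m"
  shows "similar_over (four_block_mat A B C D) (four_block_mat D C B A)"
proof (rule similar_over_intertwinerI)
  let ?W = "four_block_mat (0\<^sub>m n m) (1\<^sub>m n) (1\<^sub>m m) (0\<^sub>m m n) :: real Matrix.mat"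
  let ?V = "four_block_mat (0\<^sub>m m n) (1\<^sub>m m) (1\<^sub>m n) (0\<^sub>m n m) :: real Matrix.mat"
  have [simp]: "1\<^sub>m k * 1\<^sub>m k = (1\<^sub>m k :: real Matrix.mat)" for k
    by (rule left_mult_one_mat[OF one_carrier_mat])
  show "mat_over U ?V" by (intro mat_over_four_block[of _ m n _ m _ n]) auto
  show "mat_over U ?W" by (intro mat_over_four_block[of _ n m _ n _ m]) auto
  show "?V * ?W = 1\<^sub>m (n + m)"
    by (simp add: mult_four_block_mat[of _ m n _ m _ n _ _ m _ n] add.commute[of n])
  show "?W * ?V = 1\<^sub>m (n + m)"
    by (simp add: mult_four_block_mat[of _ n m _ n _ m _ _ n _ m])
  show "four_block_mat A B C D * ?W = ?W * four_block_mat D C B A"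
    using c by (simp add: mult_four_block_mat[of _ n n _ m _ m _ _ m _ n] mult_four_block_mat[of _ n m _ n _ m _ _ m _ n])
  show "?W \<in> carrier_mat (n + m) (n + m)" using four_block_carrier_mat[of "0\<^sub>m n m" n m "0\<^sub>m m n" m n] by (simp add: add.commute)
  show "?V \<in> carrier_mat (n + m) (n + m)" using four_block_carrier_mat[of "0\<^sub>m m n" m n "0\<^sub>m n m" n m] by (simp add: add.commute)
  show "four_block_mat D C B A \<in> carrier_mat (n + m) (n + m)"
    using four_block_carrier_mat[OF c(4,1)] by (simp add: add.commute)
qed (use c in auto)

lemma similar_over_row_extension:
  assumes AB: "similar_over A B" and A: "A \<in> carrier_mat n n" and Y: "Y \<in> carrier_mat m n" "mat_over U Y"
  shows "\<exists>Y' \<in> carrier_mat m n. mat_over U Y' \<and>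
    similar_over (four_block_mat A (0\<^sub>m n m) Y (0\<^sub>m m m)) (four_block_mat B (0\<^sub>m n m) Y' (0\<^sub>m m m))"
proof -
  obtain V W where w: "similar_mat_wit B A V W" "mat_over U V" "mat_over U W"
    "V \<in> carrier_mat n n" "W \<in> carrier_mat n n" "B \<in> carrier_mat n n"
    using similar_overE[OF AB A] .
  have "similar_mat_wit (four_block_mat B (0\<^sub>m n m) (Y * W) (0\<^sub>m m m)) (four_block_mat A (0\<^sub>m n m) Y (0\<^sub>m m m))
     (four_block_mat V (0\<^sub>m n m) (0\<^sub>m m n) (1\<^sub>m m)) (four_block_mat W (0\<^sub>m n m) (0\<^sub>m m n) (1\<^sub>m m))"
    by (rule similar_mat_wit_four_block[OF w(1) similar_mat_wit_refl]) (use w A Y in auto)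
  then have "similar_over (four_block_mat A (0\<^sub>m n m) Y (0\<^sub>m m m)) (four_block_mat B (0\<^sub>m n m) (Y * W) (0\<^sub>m m m))"
    by (rule similar_overI) (use w in \<open>auto intro!: mat_over_four_block[of _ n n _ m _ m]\<close>)
  then show ?thesis using w Y by (intro bexI[of _ "Y * W"] conjI mat_over_mult) auto
qed

lemma similar_over_column_extension:
  assumes AB: "similar_over A B" and A: "A \<in> carrier_mat n n" and Y: "Y \<in> carrier_mat n m" "mat_over U Y"
  shows "\<exists>Y' \<in> carrier_mat n m. mat_over U Y' \<and>
    similar_over (four_block_mat (0\<^sub>m m m) (0\<^sub>m m n) Y A) (four_block_mat (0\<^sub>m m m) (0\<^sub>m m n) Y' B)"
proof -
  obtain V W where w: "similar_mat_wit B A V W" "mat_over U V" "mat_over U W"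
    "V \<in> carrier_mat n n" "W \<in> carrier_mat n n" "B \<in> carrier_mat n n"
    using similar_overE[OF AB A] .
  have "similar_mat_wit (four_block_mat (0\<^sub>m m m) (0\<^sub>m m n) (V * Y) B) (four_block_mat (0\<^sub>m m m) (0\<^sub>m m n) Y A)
     (four_block_mat (1\<^sub>m m) (0\<^sub>m m n) (0\<^sub>m n m) V) (four_block_mat (1\<^sub>m m) (0\<^sub>m m n) (0\<^sub>m n m) W)"
    by (rule similar_mat_wit_four_block[OF similar_mat_wit_refl w(1)]) (use w A Y in auto)
  then have "similar_over (four_block_mat (0\<^sub>m m m) (0\<^sub>m m n) Y A) (four_block_mat (0\<^sub>m m m) (0\<^sub>m m n) (V * Y) B)"
    by (rule similar_overI) (use w in \<open>auto intro!: mat_over_four_block[of _ m m _ n _ n]\<close>)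
  then show ?thesis using w Y by (intro bexI[of _ "V * Y"] conjI mat_over_mult) auto
qed

section \<open>Realizing zero borderings by positive matrices\<close>

lemma exists_shift_positive:
  assumes A: "A \<in> carrier_mat n n" "positive_mat A" and Y: "Y \<in> carrier_mat m n" and n: "0 < n"
  shows "\<exists>Z \<in> carrier_mat m n. mat_over U Z \<and> positive_mat (Y + Z * A)"
proof -
  have "0 < (\<Sum>k<n. A $$ (k, j))" if "j < n" for j
    using A n that by (intro sum_pos) (auto simp: positive_mat_iff)
  then obtain N :: nat where N: "\<forall>(i, j) \<in> {..<m} \<times> {..<n}. - Y $$ (i, j) < real N * (\<Sum>k<n. A $$ (k, j))"
    using archimedean_finite[of "{..<m} \<times> {..<n}" "\<lambda>(i, j). \<Sum>k<n. A $$ (k, j)" "\<lambda>(i, j). - Y $$ (i, j)"]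
    by (auto simp: case_prod_beta)
  \<comment> \<open>All column sums of \<open>A\<close> are positive, so a large constant matrix suffices.\<close>
  define Z where "Z = Matrix.mat m n (\<lambda>_. real N)"
  have Z: "Z \<in> carrier_mat m n" unfolding Z_def by simp
  have "(Z * A) $$ (i, j) = real N * (\<Sum>k<n. A $$ (k, j))" if "i < m" "j < n" for i j
    using index_mult_mat_sum[OF Z A(1) that] that unfolding Z_def by (simp add: sum_distrib_left)
  then have "0 < Y $$ (i, j) + (Z * A) $$ (i, j)" if "i < m" "j < n" for i j
    using bspec[OF N, of "(i, j)"] that by simp
  then have "positive_mat (Y + Z * A)"
    unfolding positive_mat_iff using Y Z A by (simp del: index_mult_mat(1))
  moreover have "mat_over U Z" unfolding mat_over_iff Z_def by (simp add: of_nat_in)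
  ultimately show ?thesis using Z by blast
qed

lemma exists_small_split:
  assumes A: "A \<in> carrier_mat n n" "positive_mat A" and Y: "Y \<in> carrier_mat m n" "positive_mat Y"
  shows "\<exists>X \<in> carrier_mat n m. mat_over U X \<and> positive_mat X \<and> positive_mat (A - X * Y)"
proof -
  obtain N :: nat where N0: "0 < N"
    and N: "\<forall>(i, j) \<in> {..<n} \<times> {..<n}. (\<Sum>k<m. Y $$ (k, j)) < real N * A $$ (i, j)"
    using archimedean_finite[of "{..<n} \<times> {..<n}" "\<lambda>(i, j). A $$ (i, j)" "\<lambda>(i, j). \<Sum>k<m. Y $$ (k, j)"] A
    by (auto simp: case_prod_beta positive_mat_iff)
  obtain x where x: "x \<in> U" "0 < x" "x < 1 / real N" using small_in[of "1 / real N"] N0 by auto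
  define X where "X = Matrix.mat n m (\<lambda>_. x)"
  have X: "X \<in> carrier_mat n m" unfolding X_def by simp
  have small: "(X * Y) $$ (i, j) < A $$ (i, j)" if ij: "i < n" "j < n" for i j
  proof -
    have "(X * Y) $$ (i, j) = x * (\<Sum>k<m. Y $$ (k, j))"
      using index_mult_mat_sum[OF X Y(1) that] that unfolding X_def by (simp add: sum_distrib_left)
    also have "\<dots> \<le> (1 / real N) * (\<Sum>k<m. Y $$ (k, j))"
      using x Y ij by (intro mult_right_mono sum_nonneg) (auto simp: positive_mat_iff less_imp_le)
    also have "\<dots> < A $$ (i, j)" using N ij N0 by (auto simp: field_simps)
    finally show ?thesis .
  qed
  have "positive_mat (A - X * Y)"
    unfolding positive_mat_iff using Y X A small by (simp del: index_mult_mat(1))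
  moreover have "mat_over U X" "positive_mat X" unfolding mat_over_iff positive_mat_iff X_def using x by simp_all
  ultimately show ?thesis using X by blast
qed

lemma positive_mult:
  assumes "A \<in> carrier_mat a b" "B \<in> carrier_mat b c" "0 < b" "positive_mat A" "positive_mat B"
  shows "positive_mat (A * B)"
  using assms index_mult_mat_sum[OF assms(1,2)]
  unfolding positive_mat_iff by (auto simp del: index_mult_mat(1) intro!: sum_pos)

lemma mat_over_nonneg_part:
  "mat_over (nonneg_part U) M \<longleftrightarrow> mat_over U M \<and> (\<forall>i < dim_row M. \<forall>j < dim_col M. 0 \<le> M $$ (i, j))"
  unfolding mat_over_iff nonneg_part_def by auto

lemma positive_mat_over_nonneg_part:
  "positive_mat M \<Longrightarrow> mat_over U M \<Longrightarrow> mat_over (nonneg_part U) M"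
  unfolding mat_over_nonneg_part positive_mat_iff by (auto simp: less_imp_le)

text \<open>With \<open>Y'\<close> positive and \<open>B = A - X Y'\<close> positive, \<open>A = [I, X] [B; Y']\<close>. The reversed product
\<open>[B, B X; Y', Y' X]\<close> has positive blocks, and conjugating by \<open>[I, X; 0, I]\<close> clears its second block
column, because \<open>B X + X Y' X = A X\<close>.\<close>

lemma realize_row_extension:
  assumes n: "0 < n" and A: "A \<in> carrier_mat n n" "positive_mat A" "mat_over U A"
    and Y: "Y \<in> carrier_mat m n" "mat_over U Y"
  shows "\<exists>A' \<in> carrier_mat (n + m) (n + m). positive_mat A' \<and> elementary_sse (nonneg_part U) A A' \<and>
    similar_over A' (four_block_mat A (0\<^sub>m n m) Y (0\<^sub>m m m))"
proof -
  obtain Z where Z: "Z \<in> carrier_mat m n" "mat_over U Z" "positive_mat (Y + Z * A)"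
    using exists_shift_positive[OF A(1,2) Y(1) n] by blast
  define Y' where "Y' = Y + Z * A"
  have Y': "Y' \<in> carrier_mat m n" "positive_mat Y'" "mat_over U Y'"
    using Z Y A unfolding Y'_def by (auto intro!: mat_over_arith mat_over_mult)
  obtain X where X: "X \<in> carrier_mat n m" "mat_over U X" "positive_mat X" "positive_mat (A - X * Y')"
    using exists_small_split[OF A(1,2) Y'(1,2)] by blast
  define B where "B = A - X * Y'"
  have B: "B \<in> carrier_mat n n" "positive_mat B" "mat_over U B"
    using X Y' A unfolding B_def by (auto intro!: mat_over_arith mat_over_mult)
  define A' where "A' = four_block_mat B (B * X) Y' (Y' * X)"
  \<comment> \<open>The rectangular factors are block matrices whose missing blocks have height or width 0.\<close>
  define P where "P = four_block_mat (1\<^sub>m n) X (0\<^sub>m 0 n) (0\<^sub>m 0 m)"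
  define Q where "Q = four_block_mat B (0\<^sub>m n 0) Y' (0\<^sub>m m 0)"
  have P: "P \<in> carrier_mat n (n + m)" unfolding P_def using X by (auto intro: carrier_matI)
  have Q: "Q \<in> carrier_mat (n + m) n" unfolding Q_def using B Y' by (auto intro: carrier_matI)
  have BA: "B + X * Y' = A" unfolding B_def using A X Y' by (intro eq_matI) auto
  have eqA: "A = P * Q"
  proof -
    have "P * Q = four_block_mat A (0\<^sub>m n 0) (0\<^sub>m 0 n) (0\<^sub>m 0 0)"
      unfolding P_def Q_def using X Y' B BA by (simp add: mult_four_block_mat[of _ n n _ m _ 0 _ _ n _ 0])
    also have "\<dots> = A" using A by (intro eq_matI) auto
    finally show ?thesis by simp
  qed
  have eqA': "A' = Q * P"
    unfolding P_def Q_def A'_def using X Y' B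
    by (simp add: mult_four_block_mat[of _ n n _ 0 _ m _ _ n _ m])
  have A': "A' \<in> carrier_mat (n + m) (n + m)" "positive_mat A'" "mat_over U A'"
  proof -
    show "A' \<in> carrier_mat (n + m) (n + m)" unfolding A'_def using B Y' X by simp
    have *: "positive_mat (B * X)" "positive_mat (Y' * X)"
      using B Y' X n by (auto intro: positive_mult)
    then show "positive_mat A'"
      using elements_four_block_mat[of B n n "B * X" m Y' m "Y' * X"] B Y' X
      unfolding A'_def positive_mat_def by (auto simp del: elements_matD)
    show "mat_over U A'" unfolding A'_def using B Y' X
      by (intro mat_over_four_block[of _ n n _ m _ m]) (auto intro!: mat_over_mult)
  qed
  have PU: "mat_over (nonneg_part U) P" "mat_over (nonneg_part U) Q"
  proof -
    have "mat_over U P" unfolding P_def using X by (intro mat_over_four_block[of _ n n _ m _ 0]) auto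
    then show "mat_over (nonneg_part U) P"
      unfolding mat_over_nonneg_part using X by (auto simp: P_def positive_mat_iff less_imp_le)
    have "mat_over U Q" unfolding Q_def using B Y' by (intro mat_over_four_block[of _ n n _ 0 _ m]) auto
    then show "mat_over (nonneg_part U) Q"
      unfolding mat_over_nonneg_part using B Y' by (auto simp: Q_def positive_mat_iff less_imp_le)
  qed
  have "elementary_sse (nonneg_part U) A A'"
    unfolding elementary_sse_def
    by (rule exI[of _ n], rule exI[of _ "n + m"], rule exI[of _ P], rule exI[of _ Q],
        intro conjI n A(1) A'(1) P Q PU eqA eqA' positive_mat_over_nonneg_part A(2,3) A'(2,3))
      (use n in simp)
  moreover have "similar_over (four_block_mat A (0\<^sub>m n m) Y' (0\<^sub>m m m)) A'"
    unfolding A'_def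
  proof (rule similar_over_upper_unipotent[where X = X])
    have "B * X + X * (Y' * X) = (B + X * Y') * X"
      using B X Y' add_mult_distrib_mat[of B n n "X * Y'" X m] by simp
    then show "B * X + X * (Y' * X) = A * X + 0\<^sub>m n m" using BA A X by simp
  qed (use A B X Y' BA in auto)
  moreover have "similar_over (four_block_mat A (0\<^sub>m n m) Y' (0\<^sub>m m m)) (four_block_mat A (0\<^sub>m n m) Y (0\<^sub>m m m))"
    unfolding Y'_def by (rule similar_over_row_shift) (use A Y Z in auto)
  ultimately show ?thesis using A' similar_over_sym similar_over_trans by blast
qed

lemma realize_column_extension:
  assumes n: "0 < n" and A: "A \<in> carrier_mat n n" "positive_mat A" "mat_over U A"
    and Y: "Y \<in> carrier_mat n m" "mat_over U Y"
  shows "\<exists>A' \<in> carrier_mat (n + m) (n + m). positive_mat A' \<and> elementary_sse (nonneg_part U) A A' \<and>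
    similar_over A' (four_block_mat (0\<^sub>m m m) (0\<^sub>m m n) Y A)"
proof -
  obtain A' where A': "A' \<in> carrier_mat (n + m) (n + m)" "positive_mat A'"
    "elementary_sse (nonneg_part U) (transpose_mat A) A'"
    "similar_over A' (four_block_mat (transpose_mat A) (0\<^sub>m n m) (transpose_mat Y) (0\<^sub>m m m))"
    using realize_row_extension[OF n, of "transpose_mat A" "transpose_mat Y" m] A Y by auto
  have "transpose_mat (four_block_mat (transpose_mat A) (0\<^sub>m n m) (transpose_mat Y) (0\<^sub>m m m))
    = four_block_mat A Y (0\<^sub>m m n) (0\<^sub>m m m)"
    using A Y by (subst transpose_four_block_mat[of _ n n _ m _ m]) auto
  then have "similar_over (transpose_mat A') (four_block_mat A Y (0\<^sub>m m n) (0\<^sub>m m m))"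
    using similar_over_transpose[OF A'(4)] by simp
  also have "similar_over (four_block_mat A Y (0\<^sub>m m n) (0\<^sub>m m m)) (four_block_mat (0\<^sub>m m m) (0\<^sub>m m n) Y A)"
    using A Y by (intro similar_over_block_swap) auto
  finally show ?thesis
    using A' elementary_sse_transpose[OF A'(3)] by (intro bexI[of _ "transpose_mat A'"]) auto
qed

text \<open>The right notion to carry through the chain: \<open>M\<close> itself may have entries of any sign, and only a
conjugate of it is connected to \<open>A\<close> by positive matrices. Unlike positivity, this survives arbitrary
conjugacies and zero borderings over \<open>U\<close>.\<close>

definition realizable :: "real Matrix.mat \<Rightarrow> real Matrix.mat \<Rightarrow> bool" where
  "realizable A M \<longleftrightarrow> (\<exists>n A'. 0 < n \<and> A' \<in> carrier_mat n n \<and> positive_mat A' \<and> mat_over U A' \<and>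
     strong_shift_equivalent (nonneg_part U) A A' \<and> similar_over A' M)"

lemma elementary_sse_over: "elementary_sse S A B \<Longrightarrow> mat_over S B"
  unfolding elementary_sse_def by blast

lemma realizable_similar: "realizable A M \<Longrightarrow> similar_over M M' \<Longrightarrow> realizable A M'"
  unfolding realizable_def using similar_over_trans by blast

lemma realizable_row_extension:
  assumes AM: "realizable A M" and M: "M \<in> carrier_mat n n" and Y: "Y \<in> carrier_mat m n" "mat_over U Y"
  shows "realizable A (four_block_mat M (0\<^sub>m n m) Y (0\<^sub>m m m))"
proof -
  obtain k A' where A': "0 < k" "A' \<in> carrier_mat k k" "positive_mat A'" "mat_over U A'"
     "strong_shift_equivalent (nonneg_part U) A A'" "similar_over A' M"
    using AM unfolding realizable_def by blast
  have "k = n" using similar_overE[OF A'(6,2)] M by (metis carrier_matD(1))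
  note A' = A'[unfolded this]
  obtain Y' where Y': "Y' \<in> carrier_mat m n" "mat_over U Y'"
    "similar_over (four_block_mat M (0\<^sub>m n m) Y (0\<^sub>m m m)) (four_block_mat A' (0\<^sub>m n m) Y' (0\<^sub>m m m))"
    using similar_over_row_extension[OF similar_over_sym[OF A'(6)] M Y] by blast
  obtain B where B: "B \<in> carrier_mat (n + m) (n + m)" "positive_mat B" "elementary_sse (nonneg_part U) A' B"
    "similar_over B (four_block_mat A' (0\<^sub>m n m) Y' (0\<^sub>m m m))"
    using realize_row_extension[OF A'(1-4) Y'(1,2)] by blast
  have "similar_over B (four_block_mat M (0\<^sub>m n m) Y (0\<^sub>m m m))"
    using similar_over_trans[OF B(4) similar_over_sym[OF Y'(3)]] .
  then show ?thesis
    unfolding realizable_def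
    using A'(1) B(1,2) elementary_sse_over[OF B(3)] strong_shift_equivalent_snoc[OF A'(5) B(3)]
    by (intro exI[of _ "n + m"] exI[of _ B]) (auto simp: mat_over_nonneg_part)
qed

lemma realizable_column_extension:
  assumes AM: "realizable A M" and M: "M \<in> carrier_mat n n" and Y: "Y \<in> carrier_mat n m" "mat_over U Y"
  shows "realizable A (four_block_mat (0\<^sub>m m m) (0\<^sub>m m n) Y M)"
proof -
  obtain k A' where A': "0 < k" "A' \<in> carrier_mat k k" "positive_mat A'" "mat_over U A'"
     "strong_shift_equivalent (nonneg_part U) A A'" "similar_over A' M"
    using AM unfolding realizable_def by blast
  have "k = n" using similar_overE[OF A'(6,2)] M by (metis carrier_matD(1))
  note A' = A'[unfolded this]
  obtain Y' where Y': "Y' \<in> carrier_mat n m" "mat_over U Y'"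
    "similar_over (four_block_mat (0\<^sub>m m m) (0\<^sub>m m n) Y M) (four_block_mat (0\<^sub>m m m) (0\<^sub>m m n) Y' A')"
    using similar_over_column_extension[OF similar_over_sym[OF A'(6)] M Y] by blast
  obtain B where B: "B \<in> carrier_mat (n + m) (n + m)" "positive_mat B" "elementary_sse (nonneg_part U) A' B"
    "similar_over B (four_block_mat (0\<^sub>m m m) (0\<^sub>m m n) Y' A')"
    using realize_column_extension[OF A'(1-4) Y'(1,2)] by blast
  have "similar_over B (four_block_mat (0\<^sub>m m m) (0\<^sub>m m n) Y M)"
    using similar_over_trans[OF B(4) similar_over_sym[OF Y'(3)]] .
  then show ?thesis
    unfolding realizable_def
    using A'(1) B(1,2) elementary_sse_over[OF B(3)] strong_shift_equivalent_snoc[OF A'(5) B(3)]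
    by (intro exI[of _ "n + m"] exI[of _ B]) (auto simp: mat_over_nonneg_part)
qed

section \<open>Following a chain through zero borderings\<close>

inductive column_tower :: "real Matrix.mat \<Rightarrow> real Matrix.mat \<Rightarrow> bool" for C where
  base: "column_tower C C"
| extend: "column_tower C D \<Longrightarrow> D \<in> carrier_mat n n \<Longrightarrow> Y \<in> carrier_mat n m \<Longrightarrow> mat_over U Y \<Longrightarrow>
    column_tower C (four_block_mat (0\<^sub>m m m) (0\<^sub>m m n) Y D)"

lemma column_tower_trans:
  assumes "column_tower D E" "column_tower C D" shows "column_tower C E"
  using assms by (induction rule: column_tower.induct) (auto intro: column_tower.intros)

text \<open>A row bordering of \<open>C\<close> can be moved outside a tower over \<open>C\<close>: the new row block is zero in the columns
of the tower, and each column block is padded with zeros in the new rows.\<close>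

lemma column_tower_row_extension:
  assumes "column_tower C D" and C: "C \<in> carrier_mat n n" and S: "S \<in> carrier_mat k n" "mat_over U S"
  shows "\<exists>d. \<exists>Z \<in> carrier_mat k d. D \<in> carrier_mat d d \<and> mat_over U Z \<and>
    column_tower (four_block_mat C (0\<^sub>m n k) S (0\<^sub>m k k)) (four_block_mat D (0\<^sub>m d k) Z (0\<^sub>m k k))"
  using assms(1)
proof (induction rule: column_tower.induct)
  case base
  show ?case using C S by (intro exI[of _ n] bexI[of _ S]) (auto intro: column_tower.base)
next
  case (extend D d' Y m)
  then obtain d Z where Z: "Z \<in> carrier_mat k d" "D \<in> carrier_mat d d" "mat_over U Z"
    and tower: "column_tower (four_block_mat C (0\<^sub>m n k) S (0\<^sub>m k k)) (four_block_mat D (0\<^sub>m d k) Z (0\<^sub>m k k))" by blast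
  have "d' = d" using extend Z by auto
  note Y = extend(2-4)[unfolded this]
  define Y2 where "Y2 = Matrix.mat (d + k) m (\<lambda>(i, j). if i < d then Y $$ (i, j) else 0)"
  define Z2 where "Z2 = Matrix.mat k (m + d) (\<lambda>(i, j). if j < m then 0 else Z $$ (i, j - m))"
  have over: "mat_over U Y2" "mat_over U Z2"
    using Y Z unfolding Y2_def Z2_def mat_over_iff by (auto simp: zero_in)
  have "column_tower (four_block_mat C (0\<^sub>m n k) S (0\<^sub>m k k))
      (four_block_mat (0\<^sub>m m m) (0\<^sub>m m (d + k)) Y2 (four_block_mat D (0\<^sub>m d k) Z (0\<^sub>m k k)))"
    using tower over Z by (intro column_tower.extend) (auto simp: Y2_def)
  also have "four_block_mat (0\<^sub>m m m) (0\<^sub>m m (d + k)) Y2 (four_block_mat D (0\<^sub>m d k) Z (0\<^sub>m k k))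
    = four_block_mat (four_block_mat (0\<^sub>m m m) (0\<^sub>m m d) Y D) (0\<^sub>m (m + d) k) Z2 (0\<^sub>m k k)"
    using Y Z unfolding Y2_def Z2_def by (intro eq_matI) auto
  finally show ?case
    using over Y unfolding \<open>d' = d\<close> by (intro exI[of _ "m + d"] bexI[of _ Z2]) (auto simp: Z2_def)
qed

lemma column_tower_similar:
  assumes "column_tower C D" and C: "C \<in> carrier_mat n n" "similar_over C C'"
  shows "\<exists>D'. column_tower C' D' \<and> similar_over D D'"
  using assms(1)
proof (induction rule: column_tower.induct)
  case base
  show ?case using C column_tower.base by blast
next
  case (extend D d Y m)
  then obtain D' where D': "column_tower C' D'" "similar_over D D'" by blast
  obtain Y' where Y': "Y' \<in> carrier_mat d m" "mat_over U Y'"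
    "similar_over (four_block_mat (0\<^sub>m m m) (0\<^sub>m m d) Y D) (four_block_mat (0\<^sub>m m m) (0\<^sub>m m d) Y' D')"
    using similar_over_column_extension[OF D'(2) extend(2,3,4)] by blast
  have "D' \<in> carrier_mat d d" using similar_overE[OF D'(2) extend(2)] .
  then show ?case using Y' column_tower.extend[OF D'(1)] by blast
qed

lemma realizable_column_tower:
  assumes "column_tower C D" and "C \<in> carrier_mat n n" and "realizable A C"
  shows "realizable A D"
  using assms by (induction rule: column_tower.induct) (auto intro: realizable_column_extension)

text \<open>The algebraic core: after zero bordering, the two products of a pair of rectangular matrices are
conjugate.\<close>

lemma elementary_sse_similar_extensions:
  assumes P: "P \<in> carrier_mat n m" "mat_over U P" and Q: "Q \<in> carrier_mat m n"
  shows "similar_over (four_block_mat (P * Q) (0\<^sub>m n m) Q (0\<^sub>m m m)) (four_block_mat (0\<^sub>m n n) (0\<^sub>m n m) Q (Q * P))"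
  by (rule similar_over_upper_unipotent[where X = P]) (use P Q in auto)

text \<open>For \<open>C = P Q\<close> and \<open>D = Q P\<close>, border \<open>C\<close> by the row block \<open>Q\<close> and carry this through the tower up to \<open>M\<close>.
The bordered \<open>C\<close> is conjugate to a column bordering of \<open>D\<close>, so a conjugate of the bordered \<open>M\<close> is a
tower over \<open>D\<close>.\<close>

lemma realizable_tower_step:
  assumes AM: "realizable A M" and tower: "column_tower C M" and CD: "elementary_sse U C D"
  shows "\<exists>M'. realizable A M' \<and> column_tower D M'"
proof -
  obtain n m P Q where *: "C \<in> carrier_mat n n" "D \<in> carrier_mat m m"
     "P \<in> carrier_mat n m" "Q \<in> carrier_mat m n" "mat_over U P" "mat_over U Q" "C = P * Q" "D = Q * P"
    using CD unfolding elementary_sse_def by blast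
  let ?E = "four_block_mat C (0\<^sub>m n m) Q (0\<^sub>m m m)" and ?F = "four_block_mat (0\<^sub>m n n) (0\<^sub>m n m) Q D"
  obtain d Z where Z: "Z \<in> carrier_mat m d" "M \<in> carrier_mat d d" "mat_over U Z"
    "column_tower ?E (four_block_mat M (0\<^sub>m d m) Z (0\<^sub>m m m))"
    using column_tower_row_extension[OF tower *(1,4,6)] by blast
  have EF: "similar_over ?E ?F" using elementary_sse_similar_extensions[OF *(3,5,4)] *(7,8) by simp
  have "?E \<in> carrier_mat (n + m) (n + m)" using * by simp
  then obtain M' where M': "column_tower ?F M'" "similar_over (four_block_mat M (0\<^sub>m d m) Z (0\<^sub>m m m)) M'"
    using column_tower_similar[OF Z(4) _ EF] by blast
  have "column_tower D ?F" using * by (intro column_tower.extend column_tower.base) auto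
  then have "column_tower D M'" using column_tower_trans[OF M'(1)] by blast
  moreover have "realizable A M'"
    using realizable_similar[OF realizable_row_extension[OF AM Z(2,1,3)] M'(2)] .
  ultimately show ?thesis by blast
qed

lemma realizable_self:
  assumes "A \<in> carrier_mat n n" "0 < n" "positive_mat A" "mat_over U A"
  shows "realizable A A"
  unfolding realizable_def
  using assms similar_over_refl strong_shift_equivalent_refl[OF assms(1,2) positive_mat_over_nonneg_part[OF assms(3,4)]]
  by blast

lemma common_realization:
  assumes AB: "strong_shift_equivalent U A B"
    and A: "positive_mat A" "mat_over U A" and B: "positive_mat B" "mat_over U B"
  shows "\<exists>M. realizable A M \<and> realizable B M"
proof -
  note sq = strong_shift_equivalentD[OF AB]
  have Ac: "A \<in> carrier_mat (dim_row A) (dim_row A)" and Bc: "B \<in> carrier_mat (dim_row B) (dim_row B)"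
    using sq by (auto intro!: carrier_matI)
  have "\<exists>M. realizable A M \<and> column_tower A M"
    using realizable_self[OF Ac sq(2) A] column_tower.base by blast
  then have "\<exists>M. realizable A M \<and> column_tower B M"
    using strong_shift_equivalent_induct[OF AB, of "\<lambda>C. \<exists>M. realizable A M \<and> column_tower C M"]
      realizable_tower_step by blast
  then show ?thesis using realizable_column_tower[OF _ Bc realizable_self[OF Bc sq(4) B]] by blast
qed

section \<open>Adjusting the signs of the conjugating matrix\<close>

lemma conjugates_overD:
  assumes "conjugates_over U W A B" "A \<in> carrier_mat n n"
  obtains V where "mat_over U V" "mat_over U W" "V \<in> carrier_mat n n" "W \<in> carrier_mat n n" "B \<in> carrier_mat n n"
    "V * W = 1\<^sub>m n" "W * V = 1\<^sub>m n" "B = V * A * W" "A * W = W * B"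
proof -
  obtain V where *: "mat_over U W" "mat_over U V" "similar_mat_wit B A V W"
    using assms(1) unfolding conjugates_over_def by blast
  note d = similar_mat_witD2[OF assms(2) similar_mat_wit_sym[OF *(3)]]
  have "(W * B * V) * W = W * B * (V * W)" by (rule assoc_mult_mat) (use d(4-7) in auto)
  also have "\<dots> = W * B" using d(2,5,6) by simp
  finally have "A * W = W * B" unfolding d(3)[symmetric] .
  then show ?thesis
    using that[OF *(2,1) d(7,6,5,2,1) similar_mat_witD(3)[OF refl *(3)]] by blast
qed

lemma conjugates_overI:
  assumes "mat_over U V" "mat_over U W" "V \<in> carrier_mat n n" "W \<in> carrier_mat n n" "A \<in> carrier_mat n n" "B \<in> carrier_mat n n"
    "V * W = 1\<^sub>m n" "W * V = 1\<^sub>m n" "B = V * A * W"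
  shows "conjugates_over U W A B"
  unfolding conjugates_over_def using assms similar_mat_witI[of V W n B A] by blast

lemma conjugates_over_uminus:
  assumes W: "conjugates_over U W A B" and A: "A \<in> carrier_mat n n"
  shows "conjugates_over U (- W) A B"
proof -
  obtain V where V: "mat_over U V" "mat_over U W" "V \<in> carrier_mat n n" "W \<in> carrier_mat n n" "B \<in> carrier_mat n n"
    "V * W = 1\<^sub>m n" "W * V = 1\<^sub>m n" "B = V * A * W" "A * W = W * B" using conjugates_overD[OF W A] .
  have "- V * - W = V * W" "- W * - V = W * V" "- V * A * - W = V * A * W"
    using V(3,4) A by (auto simp: uminus_mult_left_mat uminus_mult_right_mat)
  then show ?thesis using V(1-8) A
    by (intro conjugates_overI[of "- V" _ n]) (auto intro: mat_over_arith)
qed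

lemma conjugates_over_signed:
  assumes W: "conjugates_over U W A B" and A: "A \<in> carrier_mat n n" "positive_mat A" and B: "positive_mat B" and n: "0 < n"
  shows "\<exists>W. conjugates_over U W A B \<and>
    (\<forall>v \<in> carrier_vec n. \<forall>k. positive_vec v \<and> transpose_mat A *\<^sub>v v = k \<cdot>\<^sub>v v \<longrightarrow> positive_vec (transpose_mat W *\<^sub>v v))"
proof -
  obtain V where V: "mat_over U V" "mat_over U W" "V \<in> carrier_mat n n" "W \<in> carrier_mat n n" "B \<in> carrier_mat n n"
    "V * W = 1\<^sub>m n" "W * V = 1\<^sub>m n" "B = V * A * W" "A * W = W * B" using conjugates_overD[OF W A(1)] .
  have t: "transpose_mat V * transpose_mat W = 1\<^sub>m n" "transpose_mat W * transpose_mat V = 1\<^sub>m n"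
    using V(3-7) by (metis transpose_mult transpose_one)+
  have eq: "transpose_mat B * transpose_mat W = transpose_mat W * transpose_mat A"
    using V(3-5,9) A(1) by (metis transpose_mult)
  have neg: "transpose_mat (- W) *\<^sub>v v = - (transpose_mat W *\<^sub>v v)" if "v \<in> carrier_vec n" for v
    using that V(4) by (intro eq_vecI) (auto simp: scalar_prod_def sum_negf)
  from intertwiner_signed_on_positive_eigenvectors[OF n _ _ _ _ _ _ t eq] V(3-5) A B
  consider "\<forall>v \<in> carrier_vec n. \<forall>k. positive_vec v \<and> transpose_mat A *\<^sub>v v = k \<cdot>\<^sub>v v \<longrightarrow> positive_vec (transpose_mat W *\<^sub>v v)"
    | "\<forall>v \<in> carrier_vec n. \<forall>k. positive_vec v \<and> transpose_mat A *\<^sub>v v = k \<cdot>\<^sub>v v \<longrightarrow> positive_vec (- (transpose_mat W *\<^sub>v v))"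
    by auto
  then show ?thesis
  proof cases
    case 1
    then show ?thesis using W by blast
  next
    case 2
    then show ?thesis using conjugates_over_uminus[OF W A(1)] neg by (intro exI[of _ "- W"]) auto
  qed
qed

lemma sends_positive_eigenvectorsI:
  assumes W: "conjugates_over U W A B" and A: "A \<in> carrier_mat n n"
    and pos: "\<And>v k. v \<in> carrier_vec n \<Longrightarrow> positive_vec v \<Longrightarrow> transpose_mat A *\<^sub>v v = k \<cdot>\<^sub>v v \<Longrightarrow> positive_vec (transpose_mat W *\<^sub>v v)"
  shows "sends_positive_eigenvectors W A B"
  unfolding sends_positive_eigenvectors_def
proof (intro allI impI, elim conjE)
  fix v assume v: "positive_vec v" and "row_eigenvector A v"
  then obtain k where k: "v \<in> carrier_vec n" "v \<noteq> 0\<^sub>v n" "transpose_mat A *\<^sub>v v = k \<cdot>\<^sub>v v"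
    using A unfolding row_eigenvector_def eigenvector_def by auto
  obtain V where V: "V \<in> carrier_mat n n" "W \<in> carrier_mat n n" "B \<in> carrier_mat n n"
    "V * W = 1\<^sub>m n" "W * V = 1\<^sub>m n" "A * W = W * B" using conjugates_overD[OF W A] by blast
  have t: "transpose_mat V * transpose_mat W = 1\<^sub>m n" and eq: "transpose_mat B * transpose_mat W = transpose_mat W * transpose_mat A"
    using V A by (metis transpose_mult transpose_one)+
  have "transpose_mat W *\<^sub>v v \<noteq> 0\<^sub>v n"
    using V k t by (intro invertible_mult_vec_nonzero[where V = "transpose_mat V"]) auto
  moreover have "transpose_mat B *\<^sub>v (transpose_mat W *\<^sub>v v) = k \<cdot>\<^sub>v (transpose_mat W *\<^sub>v v)"
    using V A k eq by (intro intertwined_eigenvector) auto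
  ultimately show "positive_vec (row_mult v W) \<and> row_eigenvector B (row_mult v W)"
    using pos[OF k(1) v k(3)] V k unfolding row_mult_def row_eigenvector_def eigenvector_def by auto
qed

text \<open>On the direct sum of \<open>M\<close> and a 1 by 1 zero block, negating the last coordinate is a symmetry of
determinant \<open>-1\<close> that is absorbed by the matrix on both sides. Transported to the conjugate \<open>A\<close>,
the relation \<open>A J = A\<close> says that \<open>J\<close> acts trivially on row eigenvectors of nonzero eigenvalue.\<close>

lemma reflection_of_zero_summand:
  assumes conj: "similar_over A (four_block_mat M (0\<^sub>m n 1) (0\<^sub>m 1 n) (0\<^sub>m 1 1))"
    and M: "M \<in> carrier_mat n n" and A: "A \<in> carrier_mat k k"
  shows "\<exists>J \<in> carrier_mat k k. mat_over U J \<and> J * J = 1\<^sub>m k \<and> J * A = A \<and> A * J = A \<and> det J = -1"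
proof -
  note One_nat_def [simp del]
  let ?E = "four_block_mat M (0\<^sub>m n 1) (0\<^sub>m 1 n) (0\<^sub>m 1 1)"
  define D :: "real Matrix.mat" where "D = four_block_mat (1\<^sub>m n) (0\<^sub>m n 1) (0\<^sub>m 1 n) (- 1 \<cdot>\<^sub>m 1\<^sub>m 1)"
  define N where "N = n + 1"
  have D: "D \<in> carrier_mat N N" unfolding D_def N_def by (rule four_block_carrier_mat) auto
  have E: "?E \<in> carrier_mat N N" unfolding N_def using M by (intro four_block_carrier_mat) auto
  obtain W V where V: "similar_mat_wit A ?E W V" "mat_over U W" "mat_over U V"
    "W \<in> carrier_mat N N" "V \<in> carrier_mat N N" "A \<in> carrier_mat N N"
    "W * V = 1\<^sub>m N" "V * W = 1\<^sub>m N" "A = W * ?E * V"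
    using similar_overE[OF similar_over_sym[OF conj] E] .
  have k: "k = N" using A V(6) by auto
  have "mat_over U (- 1 \<cdot>\<^sub>m 1\<^sub>m 1)" unfolding mat_over_iff using uminus_in[OF one_in] by simp
  then have DU: "mat_over U D" unfolding D_def by (intro mat_over_four_block[of _ n n _ 1 _ 1]) auto
  have "(- 1 \<cdot>\<^sub>m 1\<^sub>m 1) * (- 1 \<cdot>\<^sub>m 1\<^sub>m 1) = (1\<^sub>m 1 :: real Matrix.mat)"
    by (intro eq_matI) (auto simp: scalar_prod_def)
  then have DD: "D * D = 1\<^sub>m N"
    unfolding D_def N_def by (subst mult_four_block_mat[of _ n n _ 1 _ 1 _ _ n _ 1]) auto
  have ED: "?E * D = ?E" "D * ?E = ?E"
    unfolding D_def using M by (subst mult_four_block_mat[of _ n n _ 1 _ 1 _ _ n _ 1]; auto)+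
  have "det D = -1"
    unfolding D_def
    by (subst det_four_block_mat_lower_left_zero[of _ n _ 1]) auto
  note assoc = assoc_mult_mat[of _ N N _ N _ N]
  have mid: "(W * F * V) * (W * G * V) = W * (F * G) * V"
    if F: "F \<in> carrier_mat N N" and G: "G \<in> carrier_mat N N" for F G
  proof -
    have "(W * F * V) * (W * G * V) = W * F * ((V * W) * (G * V))"
      using V(4,5) F G by (simp add: assoc)
    also have "\<dots> = W * (F * G) * V"
      unfolding V(8) using V(4,5) F G by (simp add: assoc)
    finally show ?thesis .
  qed
  define J where "J = W * D * V"
  have J: "J \<in> carrier_mat N N" unfolding J_def using V(4,5) D by auto
  have "mat_over U (W * D)" using V(2,4) D DU by (intro mat_over_mult) auto
  then have "mat_over U J" unfolding J_def by (rule mat_over_mult) (use V(3-5) D in auto)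
  moreover have "J * J = 1\<^sub>m N"
    unfolding J_def mid[OF D D] DD using V(4,5,7) by simp
  moreover have "J * A = A" "A * J = A"
    unfolding J_def V(9) mid[OF D E] mid[OF E D] ED by (rule refl)+
  moreover have "det J = -1"
  proof -
    have "det J = det W * det D * det V"
      unfolding J_def using V(4,5) D by (simp add: det_mult[of _ N])
    moreover have "det W * det V = 1"
      using det_mult[OF V(4,5)] V(7) by simp
    ultimately show ?thesis using \<open>det D = -1\<close> by simp
  qed
  ultimately show ?thesis using J unfolding k by blast
qed

lemma reflected_conjugacy:
  assumes W: "conjugates_over U W A B" and A: "A \<in> carrier_mat n n"
    and J: "J \<in> carrier_mat n n" "mat_over U J" "J * J = 1\<^sub>m n" "J * A = A" "A * J = A"
  shows "conjugates_over U (J * W) A B"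
proof -
  obtain V where V: "mat_over U V" "mat_over U W" "V \<in> carrier_mat n n" "W \<in> carrier_mat n n" "B \<in> carrier_mat n n"
    "V * W = 1\<^sub>m n" "W * V = 1\<^sub>m n" "B = V * A * W" "A * W = W * B" using conjugates_overD[OF W A] .
  note assoc = assoc_mult_mat[of _ n n _ n _ n]
  have "(V * J) * (J * W) = V * ((J * J) * W)" using V(3,4) J(1) by (simp add: assoc)
  then have 1: "(V * J) * (J * W) = 1\<^sub>m n" using V(4,6) J(3) by simp
  have "(J * W) * (V * J) = J * ((W * V) * J)" using V(3,4) J(1) by (simp add: assoc)
  then have 2: "(J * W) * (V * J) = 1\<^sub>m n" using V(7) J(1,3) by simp
  have "(V * J) * A * (J * W) = V * (((J * A) * J) * W)" using V(3,4) A J(1) by (simp add: assoc)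
  also have "\<dots> = V * A * W" using V(3,4) A J(4,5) by (simp add: assoc)
  finally have 3: "B = (V * J) * A * (J * W)" using V(8) by simp
  show ?thesis
    by (rule conjugates_overI[OF _ _ _ _ A V(5) 1 2 3]) (use V(1-4) J(1,2) in \<open>auto intro: mat_over_mult\<close>)
qed

lemma reflection_fixes_eigenvector:
  assumes A: "A \<in> carrier_mat n n" and J: "J \<in> carrier_mat n n" "A * J = A"
    and v: "v \<in> carrier_vec n" "transpose_mat A *\<^sub>v v = k \<cdot>\<^sub>v v" and k: "k \<noteq> 0"
  shows "transpose_mat J *\<^sub>v v = (v :: real Matrix.vec)"
proof -
  have "k \<cdot>\<^sub>v (transpose_mat J *\<^sub>v v) = transpose_mat J *\<^sub>v (transpose_mat A *\<^sub>v v)"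
    unfolding v(2) using J v by (simp add: mult_mat_vec)
  also have "\<dots> = transpose_mat (A * J) *\<^sub>v v"
    unfolding transpose_mult[OF A J(1)] using A J(1) v(1) by (simp add: assoc_mult_mat_vec[of _ n n _ n])
  also have "\<dots> = k \<cdot>\<^sub>v v" unfolding J(2) v(2) ..
  finally have "inverse k \<cdot>\<^sub>v (k \<cdot>\<^sub>v (transpose_mat J *\<^sub>v v)) = inverse k \<cdot>\<^sub>v (k \<cdot>\<^sub>v v)" by simp
  then show ?thesis using k by (simp add: smult_smult_assoc)
qed

lemma positive_eigenvalue_nonzero:
  assumes A: "A \<in> carrier_mat n n" "positive_mat A" and n: "0 < n"
    and v: "v \<in> carrier_vec n" "positive_vec v" "A *\<^sub>v v = k \<cdot>\<^sub>v v"
  shows "k \<noteq> 0"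
proof -
  have "0 < (\<Sum>j<n. A $$ (0, j) * v $ j)"
    using A v n by (intro sum_pos) (auto simp: positive_mat_iff positive_vec_def)
  then show ?thesis using eigen_index_sum[OF A(1) v(1,3) n] by auto
qed

text \<open>The sign on positive eigenvectors is settled first, because negating \<open>W\<close> may also change the
determinant. Multiplying by \<open>J\<close> then changes only the determinant, since \<open>J\<close> fixes
the positive row eigenvectors of \<open>A\<close>.\<close>

lemma exists_orientation_preserving_conjugacy:
  assumes conj: "similar_over A B" and A: "A \<in> carrier_mat n n" "positive_mat A" and B: "positive_mat B" and n: "0 < n"
    and J: "J \<in> carrier_mat n n" "mat_over U J" "J * J = 1\<^sub>m n" "J * A = A" "A * J = A" "det J = -1"
  shows "\<exists>W. conjugates_over U W A B \<and> 0 < det W \<and> sends_positive_eigenvectors W A B"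
proof -
  obtain W where W: "conjugates_over U W A B"
    and pos: "\<And>v k. v \<in> carrier_vec n \<Longrightarrow> positive_vec v \<Longrightarrow> transpose_mat A *\<^sub>v v = k \<cdot>\<^sub>v v \<Longrightarrow> positive_vec (transpose_mat W *\<^sub>v v)"
    using conj conjugates_over_signed[OF _ A B n] unfolding similar_over_def by blast
  obtain V where V: "V \<in> carrier_mat n n" "W \<in> carrier_mat n n" "W * V = 1\<^sub>m n" using conjugates_overD[OF W A(1)] by blast
  have "det W \<noteq> 0" using det_mult[OF V(2,1)] V(3) by auto
  then consider "0 < det W" | "det W < 0" by linarith
  then show ?thesis
  proof cases
    case 1
    have "sends_positive_eigenvectors W A B"
      by (rule sends_positive_eigenvectorsI[OF W A(1)]) (rule pos)
    then show ?thesis using 1 W by blast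
  next
    case 2
    have JW: "conjugates_over U (J * W) A B" using reflected_conjugacy[OF W A(1) J(1-5)] .
    have "positive_vec (transpose_mat (J * W) *\<^sub>v v)"
      if v: "v \<in> carrier_vec n" "positive_vec v" "transpose_mat A *\<^sub>v v = k \<cdot>\<^sub>v v" for v k
    proof -
      have "k \<noteq> 0" using positive_eigenvalue_nonzero[of "transpose_mat A" n v k] A n v by simp
      then have "transpose_mat J *\<^sub>v v = v" using reflection_fixes_eigenvector[OF A(1) J(1,5) v(1,3)] by simp
      then have "transpose_mat (J * W) *\<^sub>v v = transpose_mat W *\<^sub>v v"
        using J(1) V(2) v(1) by (simp add: transpose_mult[of _ n n _ n])
      then show ?thesis using pos[OF v] by simp
    qed
    then have "sends_positive_eigenvectors (J * W) A B" by (rule sends_positive_eigenvectorsI[OF JW A(1)])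
    moreover have "0 < det (J * W)" using 2 det_mult[OF J(1) V(2)] J(6) by simp
    ultimately show ?thesis using JW by blast
  qed
qed

end

lemma dense_real_subringI:
  assumes "nondiscrete_unital_subring U"
  shows "dense_real_subring U"
proof
  have sub: "subring U (class_ring :: real ring)" and dense: "closure U = UNIV"
    using assms unfolding nondiscrete_unital_subring_def by auto
  note E = subringE[OF sub]
  show "0 \<in> U" "1 \<in> U" using E(2,3) by (simp_all add: class_ring_simps)
  show "x + y \<in> U" "x * y \<in> U" if "x \<in> U" "y \<in> U" for x y
    using E(6,7)[OF that] by (simp_all add: class_ring_simps)
  show "- x \<in> U" if "x \<in> U" for x
    using E(5)[OF that] by (simp add: class_ring_simps)
  show "\<exists>x\<in>U. 0 < x \<and> x < e" if "0 < e" for e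
  proof -
    have "e / 2 \<in> {0<..<e} \<inter> closure U" using dense that by simp
    then have "{0<..<e} \<inter> U \<noteq> {}"
      using open_Int_closure_eq_empty[OF open_greaterThanLessThan, of 0 e U] by blast
    then show ?thesis by auto
  qed
qed

theorem theorem3p1:
  fixes U :: "real set" and A B :: "real Matrix.mat"
  assumes "nondiscrete_unital_subring U"
    and "positive_mat A" and "mat_over U A"
    and "positive_mat B" and "mat_over U B"
    and "strong_shift_equivalent U A B"
  shows "\<exists>A' B' W.
    positive_mat A' \<and> positive_mat B' \<and>
    strong_shift_equivalent (nonneg_part U) A A' \<and>
    strong_shift_equivalent (nonneg_part U) B B' \<and>
    conjugates_over U W A' B' \<and>
    0 < Determinant.det W \<and>
    sends_positive_eigenvectors W A' B'"
proof -
  interpret dense_real_subring U by (rule dense_real_subringI) fact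
  obtain M where M: "realizable A M" "realizable B M" using common_realization assms by blast
  then obtain n where Mc: "M \<in> carrier_mat n n" unfolding realizable_def using similar_overE by metis
  define E where "E = four_block_mat M (0\<^sub>m n 1) (0\<^sub>m 1 n) (0\<^sub>m 1 1)"
  have "realizable A E" "realizable B E"
    unfolding E_def using M by (auto intro!: realizable_row_extension[OF _ Mc])
  then obtain k l A' B' where A': "0 < k" "A' \<in> carrier_mat k k" "positive_mat A'"
       "strong_shift_equivalent (nonneg_part U) A A'" "similar_over A' E"
    and B': "positive_mat B'" "strong_shift_equivalent (nonneg_part U) B B'" "similar_over B' E"
    unfolding realizable_def by blast
  obtain J where J: "J \<in> carrier_mat k k" "mat_over U J" "J * J = 1\<^sub>m k" "J * A' = A'" "A' * J = A'" "det J = -1"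
    using reflection_of_zero_summand[OF A'(5)[unfolded E_def] Mc A'(2)] by blast
  have "similar_over A' B'" using similar_over_trans[OF A'(5) similar_over_sym[OF B'(3)]] .
  then show ?thesis
    using exists_orientation_preserving_conjugacy[OF _ A'(2,3) B'(1) A'(1) J] A'(3,4) B'(1,2) by blast
qed

end
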